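(* Let $a_+(y),a_-(y)$ be complex-valued functions on $\{|y|<1\}\subset\mathbb{R}^3$ satisfying, for some $N\ge5$, $\alpha\ge\frac74$ and $\varepsilon>0$, $$|(1-|y|^2)^{|I|}\nabla_y^Ia_\pm(y)|\lesssim\varepsilon(1-|y|^2)^{\alpha},\qquad |I|\le N .$$ Let $U_\mu(y)$, $\mu=0,1,2,3$, be the functions determined by $$-\Box\Big(\frac{U_\mu(y)}{\tau}\Big)=\frac{x_\mu}{\tau}\,\tau^{-3}\big(|a_+(y)|^2-|a_-(y)|^2\big)$$ in the sense specified in the context, and set $$\mathbf{q}_\infty=\frac1{4\pi}\int_{|y|\le1}\big(|a_-(y)|^2-|a_+(y)|^2\big)\,dH_1 .$$ Then $$r\,\frac{U_L(y)}{\tau}\to\mathbf{q}_\infty\qquad\text{as } r\to\infty\text{ with } q=r-t<0\text{ fixed},$$ where $U_L=L^\mu U_\mu=U_0+\sum_i\omega^iU_i$.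
   Context: The Minkowski metric on $\mathbb{R}^{3+1}$ is $\mathrm{diag}(-1,1,1,1)$, used to raise and lower indices, so $x_0=-t$, $x_i=x^i$. $\Box=-\partial_t^2+\Delta_x$, $r=|x|$, $\omega=x/|x|$, $L=\partial_t+\partial_r$; for $t>r$, $\tau=\sqrt{t^2-r^2}$ and $y=x/t$. $a\lesssim b$ means $a\le Cb$ for a constant $C>0$. $dH_1$ is the standard induced measure on the unit hyperboloid $\{t^2-|x|^2=1,\ t>0\}$, i.e. $dH_1=(1-|y|^2)^{-2}dy$ in the coordinate $y=x/t$. Meaning of the determination of $U_\mu$: let $A^M_\mu$ be the solution for $t\ge2$ of $-\Box A^M_\mu=\frac{x_\mu}{\tau}\tau^{-3}(|a_+(y)|^2-|a_-(y)|^2)$, where the right-hand side is understood as zero for $|x|>t$, with vanishing Cauchy data at $t=2$. In the region $\{t-r\ge4\}$ the function $\tau A^M_\mu$ depends only on $y=x/t$, and $U_\mu(y)$, $|y|<1$, is defined by $A^M_\mu=U_\mu(y)/\tau$ for $t-r\ge4$; the function $U_\mu(y)/\tau$ is then regarded as defined on $\{t>|x|\}$, where it solves the displayed wave equation (equivalently, $U_\mu$ solves an elliptic equation on the unit hyperboloid). *)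

theory Defs
  imports "HOL-Analysis.Analysis"
begin

section \<open>Partial derivatives and functions of class C^k\<close>

text \<open>
  Everything is relative to a set \<open>S\<close> that is either open or a closed half-space. In both cases
  the derivative within \<open>S\<close> is unique; on an open set it is the ordinary one, and on the
  boundary of a half-space the transversal derivative is one-sided.
\<close>

definition dir_deriv ::
  "'a::euclidean_space set \<Rightarrow> 'a \<Rightarrow> ('a \<Rightarrow> 'b::real_normed_vector) \<Rightarrow> 'a \<Rightarrow> 'b" where
  "dir_deriv S v f p = frechet_derivative f (at p within S) v"

text \<open>
  A multi-index \<open>I\<close> is given by a list of coordinate directions (elements of \<open>Basis\<close>), with
  \<open>|I|\<close> its length. The order of the list is immaterial for functions of class C^k, \<open>k \<ge> |I|\<close>.
\<close>

primrec pderivs ::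
  "'a::euclidean_space set \<Rightarrow> 'a list \<Rightarrow> ('a \<Rightarrow> 'b::real_normed_vector) \<Rightarrow> 'a \<Rightarrow> 'b" where
  "pderivs S [] f = f"
| "pderivs S (v # I) f = dir_deriv S v (pderivs S I f)"

definition C_k_on ::
  "nat \<Rightarrow> 'a::euclidean_space set \<Rightarrow> ('a \<Rightarrow> 'b::real_normed_vector) \<Rightarrow> bool" where
  "C_k_on k S f \<longleftrightarrow>
     (\<forall>I\<in>lists Basis. length I < k \<longrightarrow> pderivs S I f differentiable_on S) \<and>
     (\<forall>I\<in>lists Basis. length I \<le> k \<longrightarrow> continuous_on S (pderivs S I f))"

section \<open>Minkowski space\<close>

text \<open>
  A spacetime point is a pair \<open>(t, x)\<close>. Covectors \<open>V\<^sub>\<mu>\<close>, \<open>\<mu> = 0, 1, 2, 3\<close>, are pairs as well: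
  \<open>V\<^sub>0\<close> is the first component, and \<open>V\<^sub>1, V\<^sub>2, V\<^sub>3\<close> are the entries of the second one. The
  wave operator acts on each component separately.
\<close>

type_synonym spacetime = "real \<times> (real ^ 3)"
type_synonym covector = "real \<times> (real ^ 3)"

definition lower :: "spacetime \<Rightarrow> covector" where
  "lower p = (- fst p, snd p)"

definition tau :: "spacetime \<Rightarrow> real" where
  "tau p = sqrt ((fst p)\<^sup>2 - (norm (snd p))\<^sup>2)"

definition vel :: "spacetime \<Rightarrow> real ^ 3" where
  "vel p = snd p /\<^sub>R fst p"

abbreviation e_t :: spacetime where
  "e_t \<equiv> (1, 0)"

abbreviation e_x :: "3 \<Rightarrow> spacetime" where
  "e_x i \<equiv> (0, axis i 1)"

definition box ::
  "spacetime set \<Rightarrow> (spacetime \<Rightarrow> 'b::real_normed_vector) \<Rightarrow> spacetime \<Rightarrow> 'b" where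
  "box S A p = - pderivs S [e_t, e_t] A p + (\<Sum>i\<in>UNIV. pderivs S [e_x i, e_x i] A p)"

text \<open>
  The contraction \<open>L\<^sup>\<mu> V\<^sub>\<mu>\<close> with \<open>L = \<partial>\<^sub>t + \<omega>\<^sup>i \<partial>\<^sub>i\<close>; no metric sign enters, because \<open>L\<close> has
  upper and \<open>V\<close> has lower indices.
\<close>

definition L_comp :: "real ^ 3 \<Rightarrow> covector \<Rightarrow> real" where
  "L_comp \<omega> V = fst V + \<omega> \<bullet> snd V"

text \<open>
  The induced measure on the unit hyperboloid in the coordinate \<open>y = x/t\<close>. Its space is the open
  unit ball, so values of an integrand outside of the ball play no role.
\<close>

definition dH1 :: "(real ^ 3) measure" where
  "dH1 = density (restrict_space lborel (ball 0 1)) (\<lambda>y. ennreal (1 / (1 - (norm y)\<^sup>2)\<^sup>2))"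

section \<open>The asymptotic source and potential\<close>

definition decaying_profile ::
  "nat \<Rightarrow> real \<Rightarrow> real \<Rightarrow> (real ^ 3 \<Rightarrow> complex) \<Rightarrow> bool" where
  "decaying_profile N \<alpha> \<epsilon> a \<longleftrightarrow>
     C_k_on N (ball 0 1) a \<and>
     (\<exists>C>0. \<forall>I\<in>lists Basis. length I \<le> N \<longrightarrow>
        (\<forall>y\<in>ball 0 1.
           norm ((1 - (norm y)\<^sup>2) ^ length I *\<^sub>R pderivs (ball 0 1) I a y)
             \<le> C * (\<epsilon> * (1 - (norm y)\<^sup>2) powr \<alpha>)))"

definition source ::
  "(real ^ 3 \<Rightarrow> complex) \<Rightarrow> (real ^ 3 \<Rightarrow> complex) \<Rightarrow> spacetime \<Rightarrow> covector" where
  "source a\<^sub>p a\<^sub>m p =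
     (if norm (snd p) < fst p
      then (1 / (tau p) ^ 3 * ((cmod (a\<^sub>p (vel p)))\<^sup>2 - (cmod (a\<^sub>m (vel p)))\<^sup>2)) *\<^sub>R
             (lower p /\<^sub>R tau p)
      else 0)"

text \<open>
  \<open>A\<close> is the classical solution on \<open>{t \<ge> 2}\<close> with vanishing Cauchy data at \<open>t = 2\<close>. On the cone
  \<open>|x| = t\<close> the extension of the source by zero is continuous as soon as
  \<open>a\<^sub>p, a\<^sub>m = O((1 - |y|\<^sup>2)\<^sup>\<alpha>)\<close> with \<open>\<alpha> > 1\<close>.
\<close>

definition future :: "spacetime set" where
  "future = {2..} \<times> UNIV"

definition is_potential ::
  "(real ^ 3 \<Rightarrow> complex) \<Rightarrow> (real ^ 3 \<Rightarrow> complex) \<Rightarrow> (spacetime \<Rightarrow> covector) \<Rightarrow> bool" where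
  "is_potential a\<^sub>p a\<^sub>m A \<longleftrightarrow>
     C_k_on 2 future A \<and>
     (\<forall>p\<in>future. - box future A p = source a\<^sub>p a\<^sub>m p) \<and>
     (\<forall>x. A (2, x) = 0 \<and> dir_deriv future e_t A (2, x) = 0)"

text \<open>
  The relation between the potential and its profile \<open>U\<close>. Every \<open>y\<close> in the open unit ball is
  the velocity \<open>x/t\<close> of some point with \<open>t - |x| \<ge> 4\<close>, so \<open>U\<close> is determined on the ball.
\<close>

definition is_profile_of :: "(real ^ 3 \<Rightarrow> covector) \<Rightarrow> (spacetime \<Rightarrow> covector) \<Rightarrow> bool" where
  "is_profile_of U A \<longleftrightarrow>
     (\<forall>p. fst p - norm (snd p) \<ge> 4 \<longrightarrow> A p = U (vel p) /\<^sub>R tau p)"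

definition q_infinity :: "(real ^ 3 \<Rightarrow> complex) \<Rightarrow> (real ^ 3 \<Rightarrow> complex) \<Rightarrow> real" where
  "q_infinity a\<^sub>p a\<^sub>m =
     1 / (4 * pi) * (LINT y|dH1. (cmod (a\<^sub>m y))\<^sup>2 - (cmod (a\<^sub>p y))\<^sup>2)"

end

theory Submission
  imports Defs
begin

text \<open>
  Kirchhoff's formula writes the potential at \<open>(t, x)\<close> as an integral of the source over the backward
  light cone. Since the source is homogeneous of degree \<open>-3\<close>, it is a superposition of charges moving
  with velocities \<open>y\<close> from the origin, and parametrizing the cone by \<open>y\<close> turns the formula into a
  sum of Lienard--Wiechert potentials: with \<open>g = (|a\<^sub>+|\<^sup>2 - |a\<^sub>-|\<^sup>2)/(1 - |y|\<^sup>2)\<^sup>2\<close>,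
  \<open>4\<pi> A\<^sub>L = \<integral> (-1 + \<omega>\<cdot>y) g(y) / D dy\<close>, \<open>D\<^sup>2 = (t - x\<cdot>y)\<^sup>2 - (t\<^sup>2 - r\<^sup>2)(1 - |y|\<^sup>2)\<close>.
  For \<open>r \<rightarrow> \<infinity>\<close> with \<open>t - r\<close> fixed, \<open>r (1 - \<omega>\<cdot>y) / D \<rightarrow> 1\<close> pointwise. The ratio is at most 2 where
  \<open>r (1 - \<omega>\<cdot>y) \<ge> 2 (t - r)\<close>; on the rest, \<open>D \<ge> \<tau> |y - x/t|\<close> makes its integral \<open>O(1/\<tau>)\<close>.
  Because \<open>U\<close> depends on the velocity only, a fixed \<open>q\<close> can be rescaled to \<open>q = -4\<close>, where the profile
  and the potential agree.
\<close>

section \<open>Calculus prerequisites\<close>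

text \<open>The potential is only C^2 up to the initial surface, and its restriction to a cone has a
  corner at the vertex. The divergence theorem is therefore used in a weak form: the derivative of a
  compactly supported Lipschitz function along a fixed direction has integral zero. All integrals
  run over the spatial displacement \<open>z\<close> along the cone, so no surface measure occurs.
  Kirchhoff's field is singular at the vertex; truncated at a small radius it becomes Lipschitz, and
  the value at the vertex reappears as a volume average instead of a flux. The number 4 is twice the
  initial time: if t - r \<ge> 4, the part of the backward cone inside |x| < t lies in t > 2, so the
  cut-off at t = 2 is not seen and the integral extends over all velocities |y| < 1. The obstacle in
  the limit is the zero of D at y = x/t. It moves with x and runs to the unit sphere, while the
  direction of x need not converge. Hence the exceptional set moves with x as well, and the bounds
  on it have to be uniform in the position of the singularity.\<close>

lemma second_difference_mean_value:
  fixes u :: "'a::real_normed_vector \<Rightarrow> real"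
  assumes h: "h > 0"
    and S: "\<And>s t. \<lbrakk>0 \<le> s; s \<le> h; 0 \<le> t; t \<le> h\<rbrakk> \<Longrightarrow> p + s *\<^sub>R a + t *\<^sub>R b \<in> S"
    and ua: "\<And>x. x \<in> S \<Longrightarrow> ((\<lambda>s. u (x + s *\<^sub>R a)) has_real_derivative ua x) (at 0)"
    and uab: "\<And>x. x \<in> S \<Longrightarrow> ((\<lambda>s. ua (x + s *\<^sub>R b)) has_real_derivative uab x) (at 0)"
  shows "\<exists>s t. 0 < s \<and> s < h \<and> 0 < t \<and> t < h \<and>
    u (p + h *\<^sub>R a + h *\<^sub>R b) - u (p + h *\<^sub>R a) - u (p + h *\<^sub>R b) + u p = h * h * uab (p + s *\<^sub>R a + t *\<^sub>R b)"
proof -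
  have shift: "((\<lambda>s. F (x + s *\<^sub>R v)) has_real_derivative d) (at s0)"
    if "((\<lambda>s. F ((x + s0 *\<^sub>R v) + s *\<^sub>R v)) has_real_derivative d) (at 0)"
    for F :: "'a \<Rightarrow> real" and x v d s0
  proof -
    have "((\<lambda>s. F (x + (s + s0) *\<^sub>R v)) has_real_derivative d) (at 0)"
      using that by (simp add: algebra_simps)
    then show ?thesis
      using DERIV_shift[of "\<lambda>s. F (x + s *\<^sub>R v)" d 0 s0] by simp
  qed
  define g where "g s = u ((p + h *\<^sub>R b) + s *\<^sub>R a) - u (p + s *\<^sub>R a)" for s
  have gd: "(g has_real_derivative (ua ((p + h *\<^sub>R b) + s *\<^sub>R a) - ua (p + s *\<^sub>R a))) (at s)"
    if "0 \<le> s" "s \<le> h" for s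
  proof -
    have "p + s *\<^sub>R a \<in> S" "p + h *\<^sub>R b + s *\<^sub>R a \<in> S"
      using S[of s 0] S[of s h] that h by (simp_all add: algebra_simps)
    then show ?thesis
      unfolding g_def by (intro DERIV_diff shift[OF ua])
  qed
  have "\<exists>s>0. s < h \<and> g h - g 0 = (h - 0) * (ua ((p + h *\<^sub>R b) + s *\<^sub>R a) - ua (p + s *\<^sub>R a))"
    by (rule MVT2[OF h gd])
  then obtain s where s: "0 < s" "s < h"
    and gs: "g h - g 0 = (h - 0) * (ua ((p + h *\<^sub>R b) + s *\<^sub>R a) - ua (p + s *\<^sub>R a))"
    by blast
  define k where "k t = ua ((p + s *\<^sub>R a) + t *\<^sub>R b)" for t
  have kd: "(k has_real_derivative uab ((p + s *\<^sub>R a) + t *\<^sub>R b)) (at t)"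
    if "0 \<le> t" "t \<le> h" for t
  proof -
    have "p + s *\<^sub>R a + t *\<^sub>R b \<in> S" using S[of s t] s that by simp
    then show ?thesis unfolding k_def by (intro shift[OF uab])
  qed
  have "\<exists>t>0. t < h \<and> k h - k 0 = (h - 0) * uab ((p + s *\<^sub>R a) + t *\<^sub>R b)"
    by (rule MVT2[OF h kd])
  then obtain t where t: "0 < t" "t < h"
    and kt: "k h - k 0 = (h - 0) * uab ((p + s *\<^sub>R a) + t *\<^sub>R b)"
    by blast
  have "g h - g 0 = h * (h * uab (p + s *\<^sub>R a + t *\<^sub>R b))"
    using gs kt unfolding k_def by (simp add: add.commute add.left_commute)
  then show ?thesis
    using s t unfolding g_def
    by (intro exI[of _ s] exI[of _ t]) (simp add: add.commute add.left_commute)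
qed

text \<open>The second difference over the parallelogram with sides \<open>h *\<^sub>R a\<close> and
  \<open>h *\<^sub>R b\<close> is symmetric in \<open>a\<close> and \<open>b\<close>. It equals
  \<open>h * h\<close> times a value of \<open>uab\<close> and also times a value of
  \<open>uba\<close>, both taken near \<open>p\<close>. The equality makes the mixed derivatives
  cancel in the divergence along the cone.\<close>

lemma mixed_partials_eq:
  fixes u :: "'a::real_normed_vector \<Rightarrow> real"
  assumes "open S" "p \<in> S"
    and ua: "\<And>x. x \<in> S \<Longrightarrow> ((\<lambda>s. u (x + s *\<^sub>R a)) has_real_derivative ua x) (at 0)"
    and ub: "\<And>x. x \<in> S \<Longrightarrow> ((\<lambda>s. u (x + s *\<^sub>R b)) has_real_derivative ub x) (at 0)"
    and uab: "\<And>x. x \<in> S \<Longrightarrow> ((\<lambda>s. ua (x + s *\<^sub>R b)) has_real_derivative uab x) (at 0)"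
    and uba: "\<And>x. x \<in> S \<Longrightarrow> ((\<lambda>s. ub (x + s *\<^sub>R a)) has_real_derivative uba x) (at 0)"
    and cont: "continuous_on S uab" "continuous_on S uba"
  shows "uab p = uba p"
proof (rule ccontr)
  assume ne: "uab p \<noteq> uba p"
  define e where "e = dist (uab p) (uba p) / 2"
  have "e > 0" using ne by (simp add: e_def)
  obtain r where r: "r > 0" "ball p r \<subseteq> S"
    using assms(1,2) open_contains_ball by blast
  obtain d1 where d1: "d1 > 0" "\<And>x. x \<in> S \<Longrightarrow> dist x p < d1 \<Longrightarrow> dist (uab x) (uab p) < e"
    using cont(1) \<open>p \<in> S\<close> \<open>e > 0\<close> unfolding continuous_on_iff by metis
  obtain d2 where d2: "d2 > 0" "\<And>x. x \<in> S \<Longrightarrow> dist x p < d2 \<Longrightarrow> dist (uba x) (uba p) < e"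
    using cont(2) \<open>p \<in> S\<close> \<open>e > 0\<close> unfolding continuous_on_iff by metis
  define m where "m = min r (min d1 d2)"
  \<comment> \<open>This side length keeps the whole parallelogram within distance \<open>m\<close>
    of \<open>p\<close>; the summand 1 also covers \<open>a = b = 0\<close>.\<close>
  define h where "h = m / (norm a + norm b + 1)"
  have m: "m > 0" "m \<le> r" "m \<le> d1" "m \<le> d2" using r d1 d2 by (auto simp: m_def)
  have h: "h > 0" using m by (simp add: h_def add_nonneg_pos)
  have near: "dist (p + s *\<^sub>R a + t *\<^sub>R b) p < m" if "0 \<le> s" "s \<le> h" "0 \<le> t" "t \<le> h" for s t
  proof -
    have "norm (s *\<^sub>R a + t *\<^sub>R b) \<le> s * norm a + t * norm b"
      using norm_triangle_ineq[of "s *\<^sub>R a" "t *\<^sub>R b"] that by simp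
    also have "\<dots> \<le> h * norm a + h * norm b"
      using that by (intro add_mono mult_right_mono) auto
    also have "\<dots> < h * (norm a + norm b + 1)" using h by (simp add: algebra_simps)
    also have "\<dots> = m"
      unfolding h_def using norm_ge_zero[of a] norm_ge_zero[of b]
      by (simp add: field_simps add_nonneg_eq_0_iff)
    finally show ?thesis by (simp add: dist_norm add.assoc)
  qed
  have inS: "p + s *\<^sub>R a + t *\<^sub>R b \<in> S" if "0 \<le> s" "s \<le> h" "0 \<le> t" "t \<le> h" for s t
    using near[OF that] m r by (auto simp: dist_commute subset_iff)
  have inS': "p + s *\<^sub>R b + t *\<^sub>R a \<in> S" if "0 \<le> s" "s \<le> h" "0 \<le> t" "t \<le> h" for s t
    using inS[of t s] that by (simp add: algebra_simps)
  obtain s t where st: "0 < s" "s < h" "0 < t" "t < h"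
    and 1: "u (p + h *\<^sub>R a + h *\<^sub>R b) - u (p + h *\<^sub>R a) - u (p + h *\<^sub>R b) + u p = h * h * uab (p + s *\<^sub>R a + t *\<^sub>R b)"
    using second_difference_mean_value[OF h inS ua uab] by blast
  obtain s' t' where st': "0 < s'" "s' < h" "0 < t'" "t' < h"
    and 2: "u (p + h *\<^sub>R b + h *\<^sub>R a) - u (p + h *\<^sub>R b) - u (p + h *\<^sub>R a) + u p = h * h * uba (p + s' *\<^sub>R b + t' *\<^sub>R a)"
    using second_difference_mean_value[OF h inS' ub uba] by blast
  define x y where "x = p + s *\<^sub>R a + t *\<^sub>R b" and "y = p + t' *\<^sub>R a + s' *\<^sub>R b"
  have "h * h * uab x = h * h * uba y"
    using 1 2 unfolding x_def y_def by (simp add: algebra_simps)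
  then have eq: "uab x = uba y" using h by simp
  have "dist (uab x) (uab p) < e"
    using near[of s t] inS[of s t] st m d1(2) by (auto simp: x_def)
  moreover have "dist (uba y) (uba p) < e"
    using near[of t' s'] inS[of t' s'] st' m d2(2) by (auto simp: y_def)
  ultimately have "dist (uab p) (uba p) < e + e"
    using eq dist_triangle_lt[of "uab p" "uab x" "uba p"] by (metis add_strict_mono dist_commute dist_triangle_less_add)
  then show False by (simp add: e_def)
qed

text \<open>By translation invariance every difference quotient of \<open>F\<close> along
  \<open>e\<close> has integral zero. The Lipschitz constant bounds the quotients, the compact
  support confines them, and dominated convergence passes to the derivative. The set
  \<open>K\<close> leaves room for kinks.\<close>

lemma has_integral_dir_deriv_0:
  fixes F :: "'a::euclidean_space \<Rightarrow> real"
  assumes lip: "L-lipschitz_on UNIV F"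
    and supp: "\<And>x. x \<notin> cball 0 R \<Longrightarrow> F x = 0"
    and K: "negligible K"
    and der: "\<And>x. x \<notin> K \<Longrightarrow> ((\<lambda>s. F (x + s *\<^sub>R e)) has_real_derivative F' x) (at 0)"
  shows "(F' has_integral 0) UNIV"
proof -
  define h where "h k = 1 / real (Suc k)" for k
  have h: "h k > 0" "h k \<le> 1" for k by (auto simp: h_def)
  have hlim: "h \<longlonglongrightarrow> 0" unfolding h_def using LIMSEQ_inverse_real_of_nat by (simp add: inverse_eq_divide)
  define f where "f k x = (if x \<in> K then 0 else (F (x + h k *\<^sub>R e) - F x) / h k)" for k x
  define G where "G x = (if x \<in> K then 0 else F' x)" for x
  \<comment> \<open>The steps \<open>h k\<close> are at most 1, so all quotients vanish outside this
    ball.\<close>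
  define B where "B = cball (0::'a) (R + norm e)"
  have cF: "continuous_on UNIV F" using lip lipschitz_on_continuous_on by blast
  have intF: "integrable lborel F"
  proof -
    have "integrable lborel (\<lambda>x. indicator (cball 0 R) x *\<^sub>R F x)"
      by (rule borel_integrable_compact) (auto intro: continuous_on_subset[OF cF])
    also have "(\<lambda>x. indicator (cball 0 R) x *\<^sub>R F x) = F"
      using supp by (auto simp: indicator_def fun_eq_iff)
    finally show ?thesis .
  qed
  have mF: "F \<in> borel_measurable borel" by (rule borel_measurable_continuous_onI[OF cF])
  have f0: "(f k has_integral 0) UNIV" for k
  proof -
    have i2: "integrable lborel (\<lambda>x. F (h k *\<^sub>R e + x))"
      and e2: "integral\<^sup>L lborel (\<lambda>x. F (h k *\<^sub>R e + x)) = integral\<^sup>L lborel F"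
      using integrable_distr_eq[of "(+) (h k *\<^sub>R e)" lborel borel F] intF mF
        integral_distr[of "(+) (h k *\<^sub>R e)" lborel borel F] lborel_distr_plus[of "h k *\<^sub>R e"]
      by simp_all
    have "((\<lambda>x. F (h k *\<^sub>R e + x) - F x) has_integral 0) UNIV"
      using has_integral_diff[OF has_integral_integral_lborel[OF i2] has_integral_integral_lborel[OF intF]] e2
      by simp
    from has_integral_divide[OF this, of "h k"]
    have "((\<lambda>x. (F (x + h k *\<^sub>R e) - F x) / h k) has_integral 0) UNIV" by (simp add: add.commute)
    then show ?thesis
      by (rule has_integral_spike[OF K, rotated]) (auto simp: f_def)
  qed
  have intB: "(\<lambda>x. if x \<in> B then L * norm e else 0) integrable_on UNIV"
  proof -
    have "(\<lambda>x. L * norm e) integrable_on B"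
      unfolding B_def by (intro integrable_on_const) (simp add: lmeasurable_cball)
    then show ?thesis by (simp add: integrable_restrict_UNIV)
  qed
  have bound: "norm (f k x) \<le> (if x \<in> B then L * norm e else 0)" for k x
  proof (cases "x \<in> B")
    case True
    have "\<bar>F (x + h k *\<^sub>R e) - F x\<bar> \<le> L * (h k * norm e)"
      using lipschitz_on_normD[OF lip, of "x + h k *\<^sub>R e" x] h(1)[of k] by simp
    then have "\<bar>F (x + h k *\<^sub>R e) - F x\<bar> / h k \<le> L * norm e"
      using h(1)[of k] by (simp add: divide_simps mult_ac)
    moreover have "0 \<le> L * norm e" using lipschitz_on_nonneg[OF lip] by simp
    ultimately show ?thesis using True h(1)[of k] by (simp add: f_def)
  next
    case False
    then have "norm x > R + norm e" by (simp add: B_def)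
    moreover have "norm (h k *\<^sub>R e) \<le> norm e" using h[of k] by (simp add: mult_left_le_one_le)
    moreover have "norm x \<le> norm (x + h k *\<^sub>R e) + norm (h k *\<^sub>R e)" by (metis add_diff_cancel norm_triangle_sub norm_triangle_ineq4)
    ultimately have "x \<notin> cball 0 R" "x + h k *\<^sub>R e \<notin> cball 0 R" using norm_ge_zero[of e] by (simp_all del: norm_ge_zero)
    then show ?thesis using False supp by (simp add: f_def)
  qed
  have conv: "(\<lambda>k. f k x) \<longlonglongrightarrow> G x" for x
  proof (cases "x \<in> K")
    case True then show ?thesis by (simp add: f_def G_def)
  next
    case False
    have "((\<lambda>s. (F (x + s *\<^sub>R e) - F x) / s) \<longlongrightarrow> F' x) (at 0)"
      using der[OF False] by (simp add: has_field_derivative_iff)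
    moreover have "filterlim h (at 0) sequentially"
      using hlim h(1) by (auto simp: filterlim_at less_imp_neq[symmetric])
    ultimately have "(\<lambda>k. (F (x + h k *\<^sub>R e) - F x) / h k) \<longlonglongrightarrow> F' x"
      by (rule filterlim_compose)
    then show ?thesis using False by (simp add: f_def G_def)
  qed
  have "G integrable_on UNIV" "(\<lambda>k. integral UNIV (f k)) \<longlonglongrightarrow> integral UNIV G"
    using dominated_convergence[of f UNIV "\<lambda>x. if x \<in> B then L * norm e else 0" G] f0 intB bound conv
    by blast+
  moreover have "integral UNIV (f k) = 0" for k using f0 by (rule integral_unique)
  ultimately have "(G has_integral 0) UNIV"
    using LIMSEQ_unique[of "\<lambda>k. 0::real" 0] by (metis (no_types, lifting) has_integral_integral tendsto_const LIMSEQ_unique integral_unique ext)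
  then show ?thesis
    by (rule has_integral_spike[OF K, rotated]) (auto simp: G_def)
qed

text \<open>On the dyadic shell between the radii \<open>r (Suc k)\<close> and \<open>r k\<close>
  the integrand is at most \<open>c k\<close>, the reciprocal of \<open>r (Suc k)\<close>. Spreading
  this constant over the full ball of radius \<open>r k\<close> still gives terms that decay like
  \<open>(1/2) ^ k\<close>, because the dimension is at least 2.\<close>

lemma nn_integral_inverse_norm_ball:
  assumes "DIM('a::euclidean_space) \<ge> 2" "R > 0"
  shows "(\<integral>\<^sup>+z. ennreal (1 / norm (z::'a)) * indicator (ball 0 R) z \<partial>lborel) < \<infinity>"
proof -
  let ?n = "DIM('a)"
  define c where "c k = 2 ^ Suc k / R" for k :: nat
  define r where "r k = R / 2 ^ k" for k :: nat
  have pos: "c k > 0" "r k > 0" for k using \<open>R > 0\<close> by (auto simp: c_def r_def)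
  have pw: "ennreal (1 / norm z) * indicator (ball 0 R) z
      \<le> (\<Sum>k. ennreal (c k) * indicator (ball 0 (r k)) z)" for z :: 'a
  proof (cases "z \<in> ball 0 R \<and> z \<noteq> 0")
    case False
    then show ?thesis by (auto simp: indicator_def)
  next
    case True
    then have z: "0 < norm z" "norm z < R" by auto
    have "\<exists>k. r k \<le> norm z"
    proof -
      obtain k where "R / norm z < 2 ^ k" using real_arch_pow[of 2 "R / norm z"] by auto
      then have "r k \<le> norm z" using z by (simp add: r_def field_simps less_imp_le)
      then show ?thesis ..
    qed
    define m where "m = (LEAST k. r k \<le> norm z)"
    have m: "r m \<le> norm z" unfolding m_def by (rule LeastI_ex) fact
    have "m \<noteq> 0" using m z by (auto simp: r_def intro: gr0I)
    then obtain k where k: "m = Suc k" using not0_implies_Suc by blast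
    have "\<not> r k \<le> norm z" using not_less_Least[of k "\<lambda>k. r k \<le> norm z"] k unfolding m_def by simp
    then have zk: "z \<in> ball 0 (r k)" by simp
    have "1 / norm z \<le> c k"
      using m z \<open>R > 0\<close> unfolding k by (simp add: r_def c_def field_simps)
    then have "ennreal (1 / norm z) * indicator (ball 0 R) z \<le> ennreal (c k) * indicator (ball 0 (r k)) z"
      using z zk by (simp add: ennreal_leI)
    also have "\<dots> \<le> (\<Sum>k. ennreal (c k) * indicator (ball 0 (r k)) z)"
    proof -
      have "f k \<le> (\<Sum>k. f k)" for f :: "nat \<Rightarrow> ennreal"
        using sum_le_suminf[of f "{k}"] by simp
      then show ?thesis .
    qed
    finally show ?thesis .
  qed
  have em: "ennreal (c k) * emeasure lborel (ball (0::'a) (r k))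
      \<le> ennreal (2 * unit_ball_vol ?n * R ^ (?n - 1) * (1/2) ^ k)" for k
  proof -
    have "c k * (unit_ball_vol ?n * r k ^ ?n) = 2 * unit_ball_vol ?n * R ^ (?n - 1) * (2 ^ k / (2 ^ k) ^ ?n)"
    proof -
      have "R ^ ?n = R * R ^ (?n - 1)" by (simp add: power_eq_if)
      then show ?thesis using \<open>R > 0\<close> by (simp add: c_def r_def power_divide)
    qed
    also have "\<dots> \<le> 2 * unit_ball_vol ?n * R ^ (?n - 1) * (1/2) ^ k"
    proof (rule mult_left_mono)
      have "(2 ^ k :: real) ^ 2 \<le> (2 ^ k) ^ ?n" using assms(1) by (intro power_increasing) auto
      then have "(2::real) ^ k / (2 ^ k) ^ ?n \<le> 2 ^ k / (2 ^ k) ^ 2" by (intro divide_left_mono) auto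
      also have "\<dots> = (1/2) ^ k" by (simp add: power2_eq_square power_divide)
      finally show "(2::real) ^ k / (2 ^ k) ^ ?n \<le> (1/2) ^ k" .
    qed (use \<open>R > 0\<close> in simp)
    finally show ?thesis
      using pos[of k] by (simp add: emeasure_ball ennreal_mult'[symmetric] ennreal_leI)
  qed
  have "(\<integral>\<^sup>+z. ennreal (1 / norm (z::'a)) * indicator (ball 0 R) z \<partial>lborel)
      \<le> (\<integral>\<^sup>+z. (\<Sum>k. ennreal (c k) * indicator (ball 0 (r k)) z) \<partial>(lborel::'a measure))"
    by (rule nn_integral_mono) (rule pw)
  also have "\<dots> = (\<Sum>k. \<integral>\<^sup>+z. ennreal (c k) * indicator (ball 0 (r k)) z \<partial>(lborel::'a measure))"
    by (rule nn_integral_suminf)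
      (intro borel_measurable_times_ennreal borel_measurable_const borel_measurable_indicator; simp)
  also have "\<dots> = (\<Sum>k. ennreal (c k) * emeasure lborel (ball (0::'a) (r k)))"
    by (simp add: nn_integral_cmult_indicator)
  also have "\<dots> \<le> (\<Sum>k. ennreal (2 * unit_ball_vol ?n * R ^ (?n - 1) * (1/2) ^ k))"
    by (intro suminf_le em) auto
  also have "\<dots> = ennreal (\<Sum>k. 2 * unit_ball_vol ?n * R ^ (?n - 1) * (1/2) ^ k)"
    using \<open>R > 0\<close> by (intro suminf_ennreal2 summable_mult summable_geometric) auto
  also have "\<dots> < \<infinity>" by simp
  finally show ?thesis .
qed

lemma absolutely_integrable_continuous_compact:
  fixes f :: "'a::euclidean_space \<Rightarrow> 'b::euclidean_space"
  assumes "compact S" "continuous_on S f"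
  shows "f absolutely_integrable_on S"
proof -
  have "set_integrable lborel S f"
    unfolding set_integrable_def using borel_integrable_compact[OF assms] .
  then show ?thesis
    unfolding set_integrable_def by (rule integrable_completion[THEN iffD2, rotated]) 
      (use \<open>set_integrable lborel S f\<close> in \<open>auto simp: set_integrable_def\<close>)
qed

lemma absolutely_integrable_inverse_norm_ball:
  assumes "DIM('a::euclidean_space) \<ge> 2"
  shows "(\<lambda>z::'a. 1 / norm z) absolutely_integrable_on ball 0 R"
proof (cases "R > 0")
  case True
  have "integrable lborel (\<lambda>z::'a. indicator (ball 0 R) z *\<^sub>R (1 / norm z))"
  proof (rule integrableI_bounded)
    have "(\<integral>\<^sup>+z. ennreal (norm (indicator (ball 0 R) z *\<^sub>R (1 / norm (z::'a)))) \<partial>lborel)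
        = (\<integral>\<^sup>+z. ennreal (1 / norm (z::'a)) * indicator (ball 0 R) z \<partial>lborel)"
      by (intro nn_integral_cong) (auto simp: indicator_def)
    then show "(\<integral>\<^sup>+z. ennreal (norm (indicator (ball 0 R) z *\<^sub>R (1 / norm (z::'a)))) \<partial>lborel) < \<infinity>"
      using nn_integral_inverse_norm_ball[OF assms True] by simp
  next
    have "ball 0 R \<in> sets (borel :: 'a measure)" by simp
    then show "(\<lambda>z::'a. indicator (ball 0 R) z *\<^sub>R (1 / norm z)) \<in> borel_measurable lborel"
      by (auto intro!: borel_measurable_indicator borel_measurable_times borel_measurable_divide)
  qed
  then show ?thesis
    unfolding set_integrable_def by (subst integrable_completion) auto
qed (simp add: absolutely_integrable_on_def not_less ball_empty)

lemma lipschitz_mult_compact: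
  fixes f g :: "'a::metric_space \<Rightarrow> real"
  assumes "compact X" "\<exists>L. L-lipschitz_on X f" "\<exists>L. L-lipschitz_on X g"
  shows "\<exists>L. L-lipschitz_on X (\<lambda>x. f x * g x)"
proof -
  obtain L M where L: "L-lipschitz_on X f" and M: "M-lipschitz_on X g" using assms by blast
  have "bounded (f ` X)" "bounded (g ` X)"
    using assms(1) L M lipschitz_on_continuous_on compact_continuous_image compact_imp_bounded by blast+
  then obtain A B where A: "\<And>x. x \<in> X \<Longrightarrow> \<bar>f x\<bar> \<le> A" and B: "\<And>x. x \<in> X \<Longrightarrow> \<bar>g x\<bar> \<le> B"
    unfolding bounded_iff by auto
  have "(\<bar>A\<bar> * M + \<bar>B\<bar> * L)-lipschitz_on X (\<lambda>x. f x * g x)"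
  proof (rule lipschitz_onI)
    fix x y assume xy: "x \<in> X" "y \<in> X"
    have "\<bar>f x * g x - f y * g y\<bar> = \<bar>f x * (g x - g y) + g y * (f x - f y)\<bar>"
      by (simp add: algebra_simps)
    also have "\<dots> \<le> \<bar>f x\<bar> * \<bar>g x - g y\<bar> + \<bar>g y\<bar> * \<bar>f x - f y\<bar>"
      by (metis abs_mult abs_triangle_ineq)
    also have "\<dots> \<le> \<bar>A\<bar> * (M * dist x y) + \<bar>B\<bar> * (L * dist x y)"
      using A[OF xy(1)] B[OF xy(2)] lipschitz_onD[OF L xy] lipschitz_onD[OF M xy]
      by (intro add_mono mult_mono) (auto simp: dist_real_def)
    finally show "dist (f x * g x) (f y * g y) \<le> (\<bar>A\<bar> * M + \<bar>B\<bar> * L) * dist x y"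
      by (simp add: dist_real_def algebra_simps)
  qed (use lipschitz_on_nonneg[OF L] lipschitz_on_nonneg[OF M] in simp)
  then show ?thesis by blast
qed

lemma lipschitz_add_ex:
  fixes f g :: "'a::metric_space \<Rightarrow> real"
  shows "\<exists>L. L-lipschitz_on X f \<Longrightarrow> \<exists>L. L-lipschitz_on X g \<Longrightarrow> \<exists>L. L-lipschitz_on X (\<lambda>x. f x + g x)"
  using lipschitz_on_add by blast

lemma norm_derivative:
  assumes "z \<noteq> 0"
  shows "((\<lambda>s. norm (z + s *\<^sub>R axis i 1 :: real^3)) has_real_derivative z $ i / norm z) (at 0)"
proof -
  have "((\<lambda>s. z + s *\<^sub>R axis i 1) has_derivative (\<lambda>s. s *\<^sub>R axis i 1)) (at 0)"
    by (auto intro!: derivative_eq_intros)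
  from has_derivative_compose[OF this, of norm, simplified, OF has_derivative_norm[OF assms]]
  show ?thesis unfolding has_field_derivative_def
    by (rule has_derivative_eq_rhs) (simp add: fun_eq_iff sgn_div_norm inner_axis inner_commute field_simps)
qed

lemma norm_sum_sq: "(\<Sum>i\<in>UNIV. z $ i * z $ i) = (norm (z::real^3))\<^sup>2"
  unfolding power2_norm_eq_inner by (simp add: inner_vec_def)

text \<open>Only continuity at the centre matters; \<open>4 / 3 * pi\<close> is the volume of the
  unit ball. Applied to \<open>M\<close>, this recovers the value of the solution at the vertex of
  the cone.\<close>

lemma integral_cball_average:
  fixes f :: "real^3 \<Rightarrow> real"
  assumes R: "R > 0" and cont: "continuous_on (cball 0 R) f"
    and \<epsilon>: "\<And>k. 0 < \<epsilon> k" "\<And>k. \<epsilon> k \<le> R" "\<epsilon> \<longlonglongrightarrow> 0"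
  shows "(\<lambda>k::nat. integral (cball 0 (\<epsilon> k)) f / \<epsilon> k ^ 3) \<longlonglongrightarrow> 4 / 3 * pi * f 0"
proof (rule LIMSEQ_I)
  fix e :: real assume e: "e > 0"
  define \<eta> where "\<eta> = e / (4 / 3 * pi) / 2"
  have \<eta>: "\<eta> > 0" using e by (simp add: \<eta>_def)
  obtain d where d: "d > 0" "\<And>z. z \<in> cball 0 R \<Longrightarrow> dist z 0 < d \<Longrightarrow> dist (f z) (f 0) < \<eta>"
    using cont \<eta> R unfolding continuous_on_iff by (metis centre_in_cball less_imp_le)
  obtain N where N: "\<And>k. k \<ge> N \<Longrightarrow> \<epsilon> k < d"
    using order_tendstoD(2)[OF \<epsilon>(3) d(1)] unfolding eventually_sequentially by blast
  have "norm (integral (cball 0 (\<epsilon> k)) f / \<epsilon> k ^ 3 - 4 / 3 * pi * f 0) < e" if "k \<ge> N" for k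
  proof -
    let ?B = "cball (0::real^3) (\<epsilon> k)"
    have vol: "measure lebesgue ?B = 4 / 3 * pi * \<epsilon> k ^ 3"
      using \<epsilon>(1)[of k] by (simp add: content_cball unit_ball_vol_3 mult_ac)
    have const: "((\<lambda>z. c) has_integral c * (4 / 3 * pi * \<epsilon> k ^ 3)) ?B" for c :: real
      using has_integral_mult_right[OF has_integral_integral[THEN iffD1, OF integrable_on_const[of ?B "1::real"]], of c]
        lmeasure_integral[of ?B] vol by (simp add: lmeasurable_cball)
    have int: "f integrable_on ?B"
      using absolutely_integrable_continuous_compact[of ?B f] cont \<epsilon>(2)[of k]
      by (meson compact_cball continuous_on_subset set_lebesgue_integral_eq_integral(1) subset_cball)
    have "((\<lambda>z. f z - f 0) has_integral (integral ?B f - f 0 * (4 / 3 * pi * \<epsilon> k ^ 3))) ?B"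
      by (intro has_integral_diff const integrable_integral int)
    moreover have "norm (f z - f 0) \<le> \<eta>" if "z \<in> ?B" for z
      using d(2)[of z] that N[OF \<open>k \<ge> N\<close>] \<epsilon>(2)[of k] by (auto simp: dist_norm less_imp_le)
    ultimately have "norm (integral ?B f - f 0 * (4 / 3 * pi * \<epsilon> k ^ 3)) \<le> \<eta> * (4 / 3 * pi * \<epsilon> k ^ 3)"
      using integral_norm_bound_integral[of "\<lambda>z. f z - f 0" ?B "\<lambda>z. \<eta>"] const[of \<eta>]
      by (metis has_integral_integrable integral_unique)
    then have "norm (integral ?B f - f 0 * (4 / 3 * pi * \<epsilon> k ^ 3)) / \<epsilon> k ^ 3 \<le> \<eta> * (4 / 3 * pi)"
      using \<epsilon>(1)[of k] by (simp add: divide_simps mult_ac)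
    also have "\<dots> < e" using e by (simp add: \<eta>_def)
    finally have "\<bar>(integral ?B f - f 0 * (4 / 3 * pi * \<epsilon> k ^ 3)) / \<epsilon> k ^ 3\<bar> < e"
      using \<epsilon>(1)[of k] unfolding abs_divide by simp
    moreover have "(integral ?B f - f 0 * (4 / 3 * pi * \<epsilon> k ^ 3)) / \<epsilon> k ^ 3
        = integral ?B f / \<epsilon> k ^ 3 - 4 / 3 * pi * f 0"
      using \<epsilon>(1)[of k] by (simp add: field_simps)
    ultimately show ?thesis by (simp only: real_norm_def)
  qed
  then show "\<exists>N. \<forall>k\<ge>N. norm (integral (cball 0 (\<epsilon> k)) f / \<epsilon> k ^ 3 - 4 / 3 * pi * f 0) < e" by blast
qed

section \<open>Kirchhoff representation of the retarded solution\<close>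

lemma e_t_in_Basis: "e_t \<in> Basis" and e_x_in_Basis: "e_x i \<in> Basis"
  by (auto simp: Basis_prod_def Basis_vec_def)

text \<open>\<open>pderivs\<close> records the derivative on basis vectors only; linearity and the
  basis expansion recover the full derivative, which the chain rule along the cone requires. Working
  within the half-space includes the boundary \<open>t = 2\<close>.\<close>

lemma pderivs_has_derivative:
  fixes u :: "spacetime \<Rightarrow> real"
  assumes "C_k_on k future u" "I \<in> lists Basis" "length I < k" "p \<in> future"
  shows "(pderivs future I u has_derivative
     (\<lambda>h. fst h * pderivs future (e_t # I) u p + (\<Sum>i\<in>UNIV. snd h $ i * pderivs future (e_x i # I) u p)))
     (at p within future)"
proof -
  let ?D = "frechet_derivative (pderivs future I u) (at p within future)"
  have "pderivs future I u differentiable (at p within future)"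
    using assms by (auto simp: C_k_on_def differentiable_on_def)
  then have D: "(pderivs future I u has_derivative ?D) (at p within future)"
    by (simp add: frechet_derivative_works)
  then interpret linear ?D by (rule has_derivative_linear)
  have "?D h = fst h * pderivs future (e_t # I) u p + (\<Sum>i\<in>UNIV. snd h $ i * pderivs future (e_x i # I) u p)" for h
  proof -
    have "h = fst h *\<^sub>R e_t + (\<Sum>i\<in>UNIV. (snd h $ i) *\<^sub>R e_x i)"
    proof (rule prod_eqI)
      have "fst (\<Sum>i\<in>(UNIV::3 set). (snd h $ i) *\<^sub>R e_x i) = 0"
        by (simp add: fst_sum)
      then show "fst h = fst (fst h *\<^sub>R e_t + (\<Sum>i\<in>UNIV. (snd h $ i) *\<^sub>R e_x i))" by simp
      have "snd (\<Sum>i\<in>(UNIV::3 set). (snd h $ i) *\<^sub>R e_x i) = snd h"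
        by (simp add: snd_sum) (metis basis_expansion scalar_mult_eq_scaleR)
      then show "snd h = snd (fst h *\<^sub>R e_t + (\<Sum>i\<in>UNIV. (snd h $ i) *\<^sub>R e_x i))" by simp
    qed
    then have "?D h = ?D (fst h *\<^sub>R e_t + (\<Sum>i\<in>UNIV. (snd h $ i) *\<^sub>R e_x i))" by metis
    also have "\<dots> = fst h * ?D e_t + (\<Sum>i\<in>UNIV. snd h $ i * ?D (e_x i))"
      by (simp only: add sum scale real_scaleR_def)
    finally show ?thesis by (simp add: dir_deriv_def)
  qed
  then show ?thesis by (intro has_derivative_eq_rhs[OF D] ext)
qed

lemma pderivs_continuous:
  assumes "C_k_on k S u" "I \<in> lists Basis" "length I \<le> k"
  shows "continuous_on S (pderivs S I u)"
  using assms by (auto simp: C_k_on_def)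

lemma at_within_future: "fst p > 2 \<Longrightarrow> at p within future = at p"
proof -
  assume "fst p > 2"
  then have "p \<in> {2::real<..} \<times> UNIV" by (cases p) auto
  moreover have "open ({2::real<..} \<times> (UNIV::(real^3) set))" by (intro open_Times) auto
  moreover have "{2::real<..} \<times> UNIV \<subseteq> future" by (auto simp: future_def)
  ultimately show ?thesis by (meson at_within_interior interior_maximal subsetD)
qed

section \<open>A scalar solution restricted to one backward light cone\<close>

locale cauchy_problem =
  fixes u S :: "spacetime \<Rightarrow> real" and t0 :: real and x0 :: "real ^ 3"
  assumes C2: "C_k_on 2 future u"
    and wave: "\<And>p. p \<in> future \<Longrightarrow> - box future u p = S p"
    and init: "\<And>x. u (2, x) = 0" "\<And>x. dir_deriv future e_t u (2, x) = 0"
    and t0: "t0 > 2"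
begin

definition D :: "spacetime list \<Rightarrow> spacetime \<Rightarrow> real" where
  "D I = pderivs future I u"

definition ret :: "(spacetime \<Rightarrow> real) \<Rightarrow> real ^ 3 \<Rightarrow> real" where
  "ret g z = g (t0 - norm z, x0 + z)"

text \<open>The backward cone of \<open>(t0, x0)\<close> reaches the initial surface over the sphere
  of radius \<open>T\<close>.\<close>

definition T :: real where "T = t0 - 2"

lemma T_pos: "T > 0" using t0 by (simp add: T_def)

lemma D_has_derivative:
  assumes "I \<in> lists Basis" "length I < 2" "p \<in> future"
  shows "(D I has_derivative (\<lambda>h. fst h * D (e_t # I) p + (\<Sum>i\<in>UNIV. snd h $ i * D (e_x i # I) p)))
     (at p within future)"
  using pderivs_has_derivative[OF C2 assms] unfolding D_def .

lemma D_has_derivative_at: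
  assumes "I \<in> lists Basis" "length I < 2" "fst p > 2"
  shows "(D I has_derivative (\<lambda>h. fst h * D (e_t # I) p + (\<Sum>i\<in>UNIV. snd h $ i * D (e_x i # I) p))) (at p)"
  using D_has_derivative[OF assms(1,2), of p] at_within_future[OF assms(3)] assms(3)
  by (cases p) (simp add: future_def)

lemma D_line_derivative:
  assumes "I \<in> lists Basis" "length I < 2" "fst p > 2"
  shows "((\<lambda>s. D I (p + s *\<^sub>R e_t)) has_real_derivative D (e_t # I) p) (at 0)"
    and "((\<lambda>s. D I (p + s *\<^sub>R e_x i)) has_real_derivative D (e_x i # I) p) (at 0)"
proof -
  have *: "((\<lambda>s. D I (p + s *\<^sub>R v)) has_real_derivative
      (fst v * D (e_t # I) p + (\<Sum>i\<in>UNIV. snd v $ i * D (e_x i # I) p))) (at 0)" for v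
  proof -
    have "((\<lambda>s. p + s *\<^sub>R v) has_derivative (\<lambda>s. s *\<^sub>R v)) (at 0)"
      by (auto intro!: derivative_eq_intros)
    from has_derivative_compose[OF this, of "D I", simplified, OF D_has_derivative_at[OF assms]]
    have "((\<lambda>s. D I (p + s *\<^sub>R v)) has_derivative
       (\<lambda>s. s * fst v * D (e_t # I) p + (\<Sum>i\<in>UNIV. s * snd v $ i * D (e_x i # I) p))) (at 0)"
      by simp
    then show ?thesis
      unfolding has_field_derivative_def
      by (rule has_derivative_eq_rhs) (simp add: fun_eq_iff sum_distrib_left algebra_simps)
  qed
  show "((\<lambda>s. D I (p + s *\<^sub>R e_t)) has_real_derivative D (e_t # I) p) (at 0)"
    using *[of e_t] by simp
  show "((\<lambda>s. D I (p + s *\<^sub>R e_x i)) has_real_derivative D (e_x i # I) p) (at 0)"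
    using *[of "e_x i"] by (simp add: axis_def if_distrib[of "\<lambda>x. x * _"] cong: if_cong)
qed

lemma D_mixed:
  assumes "fst p > 2"
  shows "D [e_t, e_x i] p = D [e_x i, e_t] p"
proof -
  let ?O = "{2::real<..} \<times> (UNIV::(real^3) set)"
  have O: "open ?O" by (intro open_Times) auto
  have p: "p \<in> ?O" using assms by (cases p) auto
  have sub: "?O \<subseteq> future" by (auto simp: future_def)
  have c: "continuous_on ?O (D [e_t, e_x i])" "continuous_on ?O (D [e_x i, e_t])"
    unfolding D_def
    by (rule continuous_on_subset[OF pderivs_continuous[OF C2] sub]; simp add: e_t_in_Basis e_x_in_Basis)+
  show ?thesis
    by (rule mixed_partials_eq[OF O p, of "D []" "e_x i" "D [e_x i]" "e_t" "D [e_t]"])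
      (rule c D_line_derivative; auto simp: e_t_in_Basis e_x_in_Basis)+
qed

lemma D_continuous:
  assumes "I \<in> lists Basis" "length I \<le> 2"
  shows "continuous_on future (D I)"
  unfolding D_def by (rule pderivs_continuous[OF C2 assms])

text \<open>Since \<open>u\<close> vanishes on the whole surface \<open>t = 2\<close>, its
  tangential derivatives vanish there together with the prescribed data. This is what makes the
  Kirchhoff field zero at \<open>norm z = T\<close>.\<close>

lemma D_initial:
  shows "D [] (2, x) = 0" "D [e_t] (2, x) = 0" "D [e_x i] (2, x) = 0"
proof -
  show "D [] (2, x) = 0" "D [e_t] (2, x) = 0" using init by (simp_all add: D_def)
  let ?L = "\<lambda>h. fst h * D [e_t] (2,x) + (\<Sum>i\<in>UNIV. snd h $ i * D [e_x i] (2,x))"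
  \<comment> \<open>The derivative is available only within the half-space, but the line in
    direction \<open>e_x i\<close> stays in its boundary.\<close>
  have d: "(D [] has_derivative ?L) (at (2,x) within (\<lambda>s. (2, x) + s *\<^sub>R e_x i) ` UNIV)"
    by (rule has_derivative_subset[OF D_has_derivative]) (auto simp: future_def)
  have "((\<lambda>s. (2, x) + s *\<^sub>R e_x i) has_derivative (\<lambda>s. s *\<^sub>R e_x i)) (at 0)"
    by (auto intro!: derivative_eq_intros)
  from has_derivative_in_compose[OF this, of "D []" ?L] d
  have "((\<lambda>s. D [] ((2, x) + s *\<^sub>R e_x i)) has_derivative (\<lambda>s. ?L (s *\<^sub>R e_x i))) (at 0)"
    by simp
  then have "((\<lambda>s::real. 0) has_derivative (\<lambda>s. ?L (s *\<^sub>R e_x i))) (at (0::real))"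
    using init(1) by (simp add: D_def)
  then have "(\<lambda>s. ?L (s *\<^sub>R e_x i)) = (\<lambda>s. 0)"
    by (rule has_derivative_unique) simp
  from fun_cong[OF this, of 1] show "D [e_x i] (2, x) = 0"
    by (simp add: axis_def if_distrib[of "\<lambda>x. x * _"] cong: if_cong)
qed

lemma ret_derivative:
  assumes "I \<in> lists Basis" "length I < 2" "z \<noteq> 0" "norm z < T"
  shows "((\<lambda>s. ret (D I) (z + s *\<^sub>R axis i 1)) has_real_derivative
    ret (D (e_x i # I)) z - z $ i / norm z * ret (D (e_t # I)) z) (at 0)"
proof -
  let ?p = "\<lambda>s. (t0 - norm (z + s *\<^sub>R axis i 1), x0 + (z + s *\<^sub>R axis i 1))"
  have n: "((\<lambda>s. norm (z + s *\<^sub>R axis i 1)) has_derivative (\<lambda>s. s * (z $ i / norm z))) (at 0)"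
    using norm_derivative[OF assms(3), of i] unfolding has_field_derivative_def
    by (rule has_derivative_eq_rhs) (simp add: fun_eq_iff)
  have p: "(?p has_derivative (\<lambda>s. (- (s * (z $ i / norm z)), s *\<^sub>R axis i 1))) (at 0)"
    by (rule has_derivative_Pair) (auto intro!: derivative_eq_intros n)
  have "fst (?p 0) > 2" using assms(4) by (simp add: T_def)
  note dI = D_has_derivative_at[OF assms(1,2) this]
  have "((\<lambda>s. D I (?p s)) has_derivative (\<lambda>s. - (s * (z $ i / norm z)) * D (e_t # I) (?p 0) +
     (\<Sum>j\<in>UNIV. (s *\<^sub>R axis i 1) $ j * D (e_x j # I) (?p 0)))) (at 0)"
    using has_derivative_compose[OF p dI] by simp
  then show ?thesis
    unfolding has_field_derivative_def ret_def
    by (rule has_derivative_eq_rhs)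
      (auto simp: fun_eq_iff axis_def algebra_simps if_distrib[of "\<lambda>x. x * _"] if_distrib[of "\<lambda>x. _ * x"] cong: if_cong)
qed

lemma ret_maps: "norm z \<le> T \<Longrightarrow> (t0 - norm z, x0 + z) \<in> future"
  by (simp add: future_def T_def)

lemma ret_continuous:
  assumes "continuous_on future g"
  shows "continuous_on (cball 0 T) (ret g)"
  unfolding ret_def
  by (rule continuous_on_compose2[OF assms]) (auto intro!: continuous_intros ret_maps)

text \<open>Up to first order the derivatives of \<open>u\<close> are Lipschitz on a compact convex
  set containing the relevant piece of the cone, and the parametrization of the cone by
  \<open>z\<close> is 2-Lipschitz. The bound persists at \<open>z = 0\<close>, where
  \<open>norm\<close> is not differentiable.\<close>

lemma ret_lipschitz:
  assumes I: "I \<in> lists Basis" "length I < 2"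
  shows "\<exists>L. L-lipschitz_on (cball 0 T) (ret (D I))"
proof -
  let ?K = "{2..t0} \<times> cball x0 T"
  have K: "compact ?K" "convex ?K" by (auto intro: compact_Times convex_Times)
  have sub: "?K \<subseteq> future" by (auto simp: future_def)
  have bd: "\<exists>B. \<forall>p\<in>?K. \<bar>D J p\<bar> \<le> B" if "J \<in> lists Basis" "length J \<le> 2" for J
  proof -
    have "continuous_on ?K (D J)" using D_continuous[OF that] sub continuous_on_subset by blast
    then have "bounded (D J ` ?K)" using K compact_continuous_image compact_imp_bounded by blast
    then show ?thesis by (auto simp: bounded_iff)
  qed
  obtain B0 where B0: "\<And>p. p \<in> ?K \<Longrightarrow> \<bar>D (e_t # I) p\<bar> \<le> B0"
    using bd[of "e_t # I"] I e_t_in_Basis by auto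
  have "\<forall>i. \<exists>B. \<forall>p\<in>?K. \<bar>D (e_x i # I) p\<bar> \<le> B"
    using bd I e_x_in_Basis by simp
  then obtain B where B: "\<And>i p. p \<in> ?K \<Longrightarrow> \<bar>D (e_x i # I) p\<bar> \<le> B i" by metis
  define L where "L = \<bar>B0\<bar> + (\<Sum>i\<in>UNIV. \<bar>B i\<bar>)"
  have lip: "norm (D I p - D I p') \<le> L * norm (p - p')" if "p \<in> ?K" "p' \<in> ?K" for p p'
  proof (rule differentiable_bound[OF K(2) _ _ that])
    show "(D I has_derivative (\<lambda>h. fst h * D (e_t # I) x + (\<Sum>i\<in>UNIV. snd h $ i * D (e_x i # I) x)))
     (at x within ?K)" if "x \<in> ?K" for x
      using has_derivative_subset[OF D_has_derivative[OF I] sub] that sub by blast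
    fix x assume x: "x \<in> ?K"
    show "onorm (\<lambda>h. fst h * D (e_t # I) x + (\<Sum>i\<in>UNIV. snd h $ i * D (e_x i # I) x)) \<le> L"
    proof (rule onorm_le)
      fix h :: spacetime
      have f: "\<bar>fst h\<bar> \<le> norm h" using norm_fst_le[of "fst h" "snd h"] by simp
      have s: "\<bar>snd h $ i\<bar> \<le> norm h" for i
        using component_le_norm_cart[of "snd h" i] norm_snd_le[of "snd h" "fst h"] by simp
      have "\<bar>fst h * D (e_t # I) x + (\<Sum>i\<in>UNIV. snd h $ i * D (e_x i # I) x)\<bar>
          \<le> \<bar>fst h * D (e_t # I) x\<bar> + (\<Sum>i\<in>UNIV. \<bar>snd h $ i * D (e_x i # I) x\<bar>)"
        using sum_abs[of "\<lambda>i. snd h $ i * D (e_x i # I) x" UNIV] by linarith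
      also have "\<dots> \<le> norm h * \<bar>B0\<bar> + (\<Sum>i\<in>UNIV. norm h * \<bar>B i\<bar>)"
        unfolding abs_mult using f s B0[OF x] B[OF x]
        by (intro add_mono sum_mono mult_mono) (auto intro: order_trans[OF _ abs_ge_self])
      also have "\<dots> = L * norm h" by (simp add: L_def algebra_simps sum_distrib_left)
      finally show "norm (fst h * D (e_t # I) x + (\<Sum>i\<in>UNIV. snd h $ i * D (e_x i # I) x)) \<le> L * norm h"
        by simp
    qed
  qed
  have "L \<ge> 0" by (simp add: L_def sum_nonneg)
  have "(L * 2)-lipschitz_on (cball 0 T) (ret (D I))"
  proof (rule lipschitz_onI)
    fix z w :: "real^3" assume zw: "z \<in> cball 0 T" "w \<in> cball 0 T"
    let ?p = "\<lambda>z. (t0 - norm z, x0 + z)"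
    have K: "?p z \<in> ?K" "?p w \<in> ?K" using zw by (auto simp: T_def dist_norm)
    have "norm (?p z - ?p w) \<le> norm (norm w - norm z) + norm (z - w)"
      using norm_Pair_le[of "norm w - norm z" "z - w"] by simp
    also have "norm (norm w - norm z) \<le> norm (z - w)"
      using norm_triangle_ineq3[of w z] by (simp add: norm_minus_commute)
    finally have "norm (?p z - ?p w) \<le> 2 * norm (z - w)" by simp
    then have "L * norm (?p z - ?p w) \<le> L * (2 * norm (z - w))"
      using \<open>L \<ge> 0\<close> by (rule mult_left_mono)
    then show "dist (ret (D I) z) (ret (D I) w) \<le> L * 2 * dist z w"
      using lip[OF K] unfolding ret_def dist_norm by (simp only: mult.assoc)
  qed (use \<open>L \<ge> 0\<close> in simp)
  then show ?thesis by blast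
qed

text \<open>
  With \<open>[g](z) = g (t0 - |z|, x0 + z)\<close> and \<open>\<rho> = |z|\<close>, Kirchhoff's field
  \<open>[\<nabla>u]/\<rho> + [u] z/\<rho>\<^sup>3 + [\<partial>\<^sub>t u] z/\<rho>\<^sup>2\<close> has divergence \<open>-[S]/\<rho>\<close> away from the origin.
  \<open>W\<close> is this field times \<open>\<rho>\<^sup>3\<close>, and \<open>Y \<epsilon>\<close> is the field itself, truncated at \<open>\<rho> = \<epsilon>\<close> and extended
  by zero across \<open>\<rho> = T\<close>, where it vanishes because of the Cauchy data.
\<close>

definition W :: "3 \<Rightarrow> real ^ 3 \<Rightarrow> real" where
  "W i z = (norm z)\<^sup>2 * ret (D [e_x i]) z + norm z * z $ i * ret (D [e_t]) z + z $ i * ret (D []) z"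

definition Y :: "real \<Rightarrow> 3 \<Rightarrow> real ^ 3 \<Rightarrow> real" where
  "Y \<epsilon> i z = (if norm z \<le> T then W i z * (1 / max \<epsilon> (norm z)) ^ 3 else 0)"

lemma W_sphere: "norm z = T \<Longrightarrow> W i z = 0"
  by (simp add: W_def ret_def T_def D_initial)

text \<open>The truncation makes the negative power of \<open>norm z\<close> Lipschitz. Because
  \<open>W\<close> vanishes on the sphere of radius \<open>T\<close>, the extension by zero is the
  same as composing with the nearest-point projection onto the ball, which has Lipschitz constant
  1.\<close>

lemma Y_lipschitz:
  assumes "\<epsilon> > 0"
  shows "\<exists>L. L-lipschitz_on UNIV (Y \<epsilon> i)"
proof -
  let ?B = "cball (0::real^3) T"
  note m = lipschitz_mult_compact[OF compact_cball]
  have n: "\<exists>L. L-lipschitz_on ?B norm"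
    by (rule exI[of _ 1], rule lipschitz_onI) (auto simp: dist_norm norm_triangle_ineq3)
  have c: "\<exists>L. L-lipschitz_on ?B (\<lambda>z. z $ i)"
    by (rule exI[of _ 1], rule lipschitz_onI) (auto simp: dist_norm component_le_norm_cart simp flip: vector_minus_component)
  have r: "\<exists>L. L-lipschitz_on ?B (\<lambda>z. 1 / max \<epsilon> (norm z))"
  proof (rule exI[of _ "1 / \<epsilon>^2"], rule lipschitz_onI)
    fix z w :: "real^3"
    let ?a = "max \<epsilon> (norm z)" and ?b = "max \<epsilon> (norm w)"
    have ab: "?a \<ge> \<epsilon>" "?b \<ge> \<epsilon>" by auto
    then have pos: "?a > 0" "?b > 0" using assms by linarith+
    have "\<bar>1 / ?a - 1 / ?b\<bar> = \<bar>?b - ?a\<bar> / (?a * ?b)"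
      using pos by (simp add: field_simps abs_mult abs_divide diff_frac_eq)
    also have "\<dots> \<le> norm (z - w) / (\<epsilon> * \<epsilon>)"
    proof (rule frac_le)
      show "\<bar>?b - ?a\<bar> \<le> norm (z - w)"
        using norm_triangle_ineq3[of z w] by (auto simp: max_def abs_if split: if_splits)
      show "\<epsilon> * \<epsilon> \<le> ?a * ?b" using ab assms by (intro mult_mono) auto
    qed (use assms in auto)
    finally show "dist (1 / ?a) (1 / ?b) \<le> 1 / \<epsilon>^2 * dist z w"
      by (simp add: dist_norm power2_eq_square)
  qed simp
  have W: "\<exists>L. L-lipschitz_on ?B (W i)"
    unfolding W_def power2_eq_square
    by (intro lipschitz_add_ex m n c ret_lipschitz) (auto simp: e_t_in_Basis e_x_in_Basis)
  have "\<exists>L. L-lipschitz_on ?B (\<lambda>z. W i z * (1 / max \<epsilon> (norm z)) ^ 3)"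
    unfolding power3_eq_cube by (intro m W r)
  then obtain L where L: "L-lipschitz_on ?B (\<lambda>z. W i z * (1 / max \<epsilon> (norm z)) ^ 3)" ..
  let ?P = "closest_point ?B"
  have P: "?P z \<in> ?B" for z using closest_point_in_set[of ?B z] T_pos by auto
  have PB: "1-lipschitz_on UNIV ?P"
    by (rule lipschitz_onI) (use closest_point_lipschitz[of ?B] T_pos in auto)
  have Yeq: "Y \<epsilon> i z = W i (?P z) * (1 / max \<epsilon> (norm (?P z))) ^ 3" for z
  proof (cases "norm z \<le> T")
    case True
    then show ?thesis by (simp add: Y_def closest_point_self)
  next
    case False
    have ne: "interior ?B \<noteq> {}" using T_pos by simp
    have "?P z \<in> rel_frontier ?B"
      by (rule closest_point_in_rel_frontier)
        (use False T_pos in \<open>simp_all add: affine_hull_nonempty_interior[OF ne] rel_interior_nonempty_interior[OF ne]\<close>)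
    then have "norm (?P z) = T" using T_pos by (simp add: rel_frontier_nonempty_interior[OF ne])
    then show ?thesis using False by (simp add: Y_def W_sphere)
  qed
  have "(L * 1)-lipschitz_on UNIV (\<lambda>z. W i (?P z) * (1 / max \<epsilon> (norm (?P z))) ^ 3)"
    by (rule lipschitz_on_compose2[OF PB]) (rule lipschitz_on_subset[OF L], use P in auto)
  then show ?thesis by (subst Yeq[abs_def]) blast
qed

definition W' :: "3 \<Rightarrow> real ^ 3 \<Rightarrow> real" where
  "W' i z = 2 * z $ i * ret (D [e_x i]) z
     + (norm z)\<^sup>2 * (ret (D [e_x i, e_x i]) z - z $ i / norm z * ret (D [e_t, e_x i]) z)
     + (z $ i / norm z * z $ i + norm z) * ret (D [e_t]) z
     + norm z * z $ i * (ret (D [e_x i, e_t]) z - z $ i / norm z * ret (D [e_t, e_t]) z)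
     + ret (D []) z + z $ i * (ret (D [e_x i]) z - z $ i / norm z * ret (D [e_t]) z)"

lemma W_derivative:
  assumes "z \<noteq> 0" "norm z < T"
  shows "((\<lambda>s. W i (z + s *\<^sub>R axis i 1)) has_real_derivative W' i z) (at 0)"
proof -
  have c: "((\<lambda>s. (z + s *\<^sub>R axis i 1) $ i) has_real_derivative 1) (at 0)"
    by (auto intro!: derivative_eq_intros simp: axis_def)
  note r = ret_derivative[OF _ _ assms, of _ i]
  have r1: "((\<lambda>s. ret (D [e_x i]) (z + s *\<^sub>R axis i 1)) has_real_derivative
      ret (D [e_x i, e_x i]) z - z $ i / norm z * ret (D [e_t, e_x i]) z) (at 0)"
    by (rule r) (auto simp: e_x_in_Basis)
  have r2: "((\<lambda>s. ret (D [e_t]) (z + s *\<^sub>R axis i 1)) has_real_derivative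
      ret (D [e_x i, e_t]) z - z $ i / norm z * ret (D [e_t, e_t]) z) (at 0)"
    by (rule r) (auto simp: e_t_in_Basis)
  have r3: "((\<lambda>s. ret (D []) (z + s *\<^sub>R axis i 1)) has_real_derivative
      ret (D [e_x i]) z - z $ i / norm z * ret (D [e_t]) z) (at 0)"
    by (rule r) auto
  show ?thesis
    unfolding W_def W'_def power2_eq_square
    by (rule derivative_eq_intros norm_derivative[OF assms(1)] c r1 r2 r3 refl)+
      (use assms(1) in \<open>simp add: field_simps power2_eq_square axis_def\<close>)
qed

text \<open>The divergence of \<open>W\<close>, up to the source term.\<close>

definition M :: "real ^ 3 \<Rightarrow> real" where
  "M z = 3 * ((\<Sum>i\<in>UNIV. z $ i * ret (D [e_x i]) z) + ret (D []) z + norm z * ret (D [e_t]) z)"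

text \<open>Beyond the truncation radius the field is \<open>W\<close> divided by
  \<open>norm z ^ 3\<close>. Differentiating that factor contributes
  \<open>- M z / norm z ^ 3\<close> by this identity, which cancels the \<open>M\<close> in the
  divergence of \<open>W\<close> and leaves only the source.\<close>

lemma sum_W: "(\<Sum>i\<in>UNIV. z $ i * W i z) = (norm z)\<^sup>2 / 3 * M z"
proof -
  have "(\<Sum>i\<in>UNIV. z $ i * W i z) = (norm z)\<^sup>2 * (\<Sum>i\<in>UNIV. z $ i * ret (D [e_x i]) z)
      + norm z * (\<Sum>i\<in>UNIV. z $ i * z $ i) * ret (D [e_t]) z + (\<Sum>i\<in>UNIV. z $ i * z $ i) * ret (D []) z"
    unfolding W_def by (simp add: sum.distrib algebra_simps sum_distrib_left)
  then show ?thesis by (simp only: norm_sum_sq) (simp add: M_def algebra_simps)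
qed

lemma ret_wave:
  assumes "norm z \<le> T"
  shows "(\<Sum>i\<in>UNIV. ret (D [e_x i, e_x i]) z) - ret (D [e_t, e_t]) z = - ret S z"
  using wave[OF ret_maps[OF assms]] by (simp add: box_def D_def ret_def)

text \<open>The mixed second derivatives arise once from the time dependence of
  \<open>ret (D [e_x i])\<close> and once from the space dependence of \<open>ret (D [e_t])\<close>,
  with opposite signs. The pure second derivatives combine to the wave operator.\<close>

lemma sum_W':
  assumes "z \<noteq> 0" "norm z < T"
  shows "(\<Sum>i\<in>UNIV. W' i z) = M z - (norm z)\<^sup>2 * ret S z"
proof -
  have nz: "norm z \<noteq> 0" using assms by simp
  have mixed: "ret (D [e_x i, e_t]) z = ret (D [e_t, e_x i]) z" for i
    unfolding ret_def using D_mixed[of _ i] assms by (simp add: T_def)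
  have W': "W' i z = 3 * (z $ i * ret (D [e_x i]) z) + (norm z)\<^sup>2 * ret (D [e_x i, e_x i]) z
     + norm z * ret (D [e_t]) z - z $ i * z $ i * ret (D [e_t, e_t]) z + ret (D []) z" for i
    unfolding W'_def mixed using nz by (simp add: field_simps power2_eq_square)
  have "(\<Sum>i\<in>UNIV. W' i z) = 3 * (\<Sum>i\<in>UNIV. z $ i * ret (D [e_x i]) z)
     + (norm z)\<^sup>2 * (\<Sum>i\<in>UNIV. ret (D [e_x i, e_x i]) z)
     + 3 * (norm z * ret (D [e_t]) z) - (\<Sum>i\<in>UNIV. z $ i * z $ i) * ret (D [e_t, e_t]) z + 3 * ret (D []) z"
    unfolding W' by (simp add: sum.distrib sum_subtractf sum_distrib_left sum_distrib_right)
  also have "\<dots> = M z + (norm z)\<^sup>2 * ((\<Sum>i\<in>UNIV. ret (D [e_x i, e_x i]) z) - ret (D [e_t, e_t]) z)"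
    unfolding norm_sum_sq by (simp add: M_def algebra_simps)
  finally show ?thesis using ret_wave[of z] assms by simp
qed

text \<open>The weight of the source in the divergence of the truncated field:
  \<open>1 / norm z\<close> outside the ball of radius \<epsilon> and
  \<open>(norm z)\<^sup>2 / \<epsilon> ^ 3\<close> inside. It is continuous, lies below
  \<open>1 / norm z\<close> away from the origin, and tends to it as \<epsilon> goes to 0.\<close>

definition kern :: "real \<Rightarrow> real ^ 3 \<Rightarrow> real" where
  "kern \<epsilon> z = (min \<epsilon> (norm z))\<^sup>2 / (\<epsilon>\<^sup>2 * max \<epsilon> (norm z))"

text \<open>The divergence of \<open>Y \<epsilon>\<close> off the origin and two spheres.\<close>

definition G :: "real \<Rightarrow> real ^ 3 \<Rightarrow> real" where
  "G \<epsilon> z = (if norm z \<le> \<epsilon> then M z / \<epsilon> ^ 3 else 0) - (if norm z \<le> T then ret S z * kern \<epsilon> z else 0)"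

lemma line_eventually_derivative:
  fixes f :: "real^3 \<Rightarrow> real"
  assumes "((\<lambda>s. f (z + s *\<^sub>R e)) has_real_derivative d) (at 0)" "open O'" "z \<in> O'"
    and "\<And>w. w \<in> O' \<Longrightarrow> f w = g w"
  shows "((\<lambda>s. g (z + s *\<^sub>R e)) has_real_derivative d) (at 0)"
proof (rule has_field_derivative_transform_within_open[OF assms(1)])
  show "open ((\<lambda>s. z + s *\<^sub>R e) -` O')"
    by (intro open_vimage assms(2) continuous_intros)
qed (use assms in auto)

lemma Y_derivative:
  assumes "\<epsilon> > 0" "\<epsilon> < T" "z \<noteq> 0" "norm z \<noteq> \<epsilon>" "norm z \<noteq> T"
  shows "\<exists>d. (\<forall>i. ((\<lambda>s. Y \<epsilon> i (z + s *\<^sub>R axis i 1)) has_real_derivative d i) (at 0)) \<and>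
    (\<Sum>i\<in>UNIV. d i) = G \<epsilon> z"
proof -
  have nz: "norm z > 0" using assms by simp
  consider "norm z < \<epsilon>" | "\<epsilon> < norm z" "norm z < T" | "T < norm z" using assms by linarith
  then show ?thesis
  proof cases
    case 1
    have zT: "norm z < T" using 1 assms by simp
    have "((\<lambda>s. Y \<epsilon> i (z + s *\<^sub>R axis i 1)) has_real_derivative W' i z * (1 / \<epsilon>) ^ 3) (at 0)" for i
    proof (rule line_eventually_derivative[of "\<lambda>w. W i w * (1 / \<epsilon>) ^ 3" _ _ _ "ball 0 \<epsilon>"])
      show "((\<lambda>s. W i (z + s *\<^sub>R axis i 1) * (1 / \<epsilon>) ^ 3) has_real_derivative W' i z * (1 / \<epsilon>) ^ 3) (at 0)"
        by (intro DERIV_cmult_right W_derivative assms zT)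
    qed (use 1 assms in \<open>auto simp: Y_def max_def\<close>)
    moreover have "(\<Sum>i\<in>UNIV. W' i z * (1 / \<epsilon>) ^ 3) = G \<epsilon> z"
      unfolding sum_distrib_right[symmetric] sum_W'[OF assms(3) zT] G_def kern_def
      using 1 zT assms(1) by (simp add: max_def min_def field_simps power2_eq_square power3_eq_cube)
    ultimately show ?thesis by (intro exI[of _ "\<lambda>i. W' i z * (1 / \<epsilon>) ^ 3"]) simp
  next
    case 2
    define d where "d i = W' i z * (1 / norm z) ^ 3 - 3 * (z $ i * W i z) / norm z ^ 5" for i
    have "((\<lambda>s. Y \<epsilon> i (z + s *\<^sub>R axis i 1)) has_real_derivative d i) (at 0)" for i
    proof (rule line_eventually_derivative[of "\<lambda>w. W i w * (1 / norm w) ^ 3" _ _ _ "- cball 0 \<epsilon> \<inter> ball 0 T"])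
      show "((\<lambda>s. W i (z + s *\<^sub>R axis i 1) * (1 / norm (z + s *\<^sub>R axis i 1)) ^ 3) has_real_derivative d i) (at 0)"
      proof -
        have "((\<lambda>s. 1 / norm (z + s *\<^sub>R axis i 1)) has_real_derivative - (z $ i) / norm z ^ 3) (at 0)"
          using DERIV_inverse_fun[OF norm_derivative[OF assms(3), of i]] nz
          by (simp add: divide_inverse power3_eq_cube mult_ac)
        note DERIV_mult[OF W_derivative[OF assms(3) 2(2), of i] DERIV_power[OF this, of 3]]
        then show ?thesis
          by (rule DERIV_cong) (use nz in \<open>simp add: d_def field_simps eval_nat_numeral\<close>)
      qed
      show "open (- cball 0 \<epsilon> \<inter> ball 0 T)" by (intro open_Int) auto
    qed (use 2 assms in \<open>auto simp: Y_def max_def\<close>)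
    moreover have "(\<Sum>i\<in>UNIV. d i) = G \<epsilon> z"
    proof -
      have "(\<Sum>i\<in>UNIV. d i) = (M z - (norm z)\<^sup>2 * ret S z) * (1 / norm z) ^ 3 - 3 * ((norm z)\<^sup>2 / 3 * M z) / norm z ^ 5"
        unfolding d_def sum_subtractf sum_distrib_right[symmetric] sum_distrib_left[symmetric]
          sum_divide_distrib[symmetric] sum_W'[OF assms(3) 2(2)] sum_W ..
      also have "\<dots> = - (ret S z / norm z)"
        using nz by (simp add: field_simps eval_nat_numeral)
      also have "\<dots> = G \<epsilon> z"
        unfolding G_def kern_def using 2 assms(1) by (simp add: max_def min_def)
      finally show ?thesis .
    qed
    ultimately show ?thesis by blast
  next
    case 3
    have "((\<lambda>s. Y \<epsilon> i (z + s *\<^sub>R axis i 1)) has_real_derivative 0) (at 0)" for i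
      by (rule line_eventually_derivative[of "\<lambda>w. 0" _ _ _ "- cball 0 T"]) (use 3 in \<open>auto simp: Y_def\<close>)
    moreover have "G \<epsilon> z = 0" using 3 assms by (simp add: G_def)
    ultimately show ?thesis by (intro exI[of _ "\<lambda>_. 0"]) simp
  qed
qed

text \<open>Differentiability of the field may fail at the origin and on the two spheres; they form
  a null set across which the field stays Lipschitz, so they contribute nothing.\<close>

lemma G_integral:
  assumes "\<epsilon> > 0" "\<epsilon> < T"
  shows "(G \<epsilon> has_integral 0) UNIV"
proof -
  let ?K = "{0} \<union> sphere (0::real^3) \<epsilon> \<union> sphere 0 T"
  have K: "negligible ?K" by (intro negligible_Un negligible_sphere) auto
  define F where "F i z = deriv (\<lambda>s. Y \<epsilon> i (z + s *\<^sub>R axis i 1)) 0" for i z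
  have F: "((\<lambda>s. Y \<epsilon> i (z + s *\<^sub>R axis i 1)) has_real_derivative F i z) (at 0)"
    and FG: "(\<Sum>i\<in>UNIV. F i z) = G \<epsilon> z" if "z \<notin> ?K" for i z
  proof -
    obtain d where d: "\<And>i. ((\<lambda>s. Y \<epsilon> i (z + s *\<^sub>R axis i 1)) has_real_derivative d i) (at 0)"
      "(\<Sum>i\<in>UNIV. d i) = G \<epsilon> z"
      using Y_derivative[OF assms, of z] \<open>z \<notin> ?K\<close> by auto
    have "F i z = d i" for i unfolding F_def by (rule DERIV_imp_deriv[OF d(1)])
    then show "((\<lambda>s. Y \<epsilon> i (z + s *\<^sub>R axis i 1)) has_real_derivative F i z) (at 0)"
      "(\<Sum>i\<in>UNIV. F i z) = G \<epsilon> z" using d by simp_all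
  qed
  have "(F i has_integral 0) UNIV" for i
  proof -
    obtain L where "L-lipschitz_on UNIV (Y \<epsilon> i)" using Y_lipschitz[OF assms(1)] by blast
    then show ?thesis
      by (rule has_integral_dir_deriv_0[where R = T and K = ?K]) (use F K in \<open>auto simp: Y_def\<close>)
  qed
  then have "((\<lambda>z. \<Sum>i\<in>UNIV. F i z) has_integral (\<Sum>i\<in>(UNIV::3 set). 0)) UNIV"
    by (intro has_integral_sum) auto
  then have "((\<lambda>z. \<Sum>i\<in>UNIV. F i z) has_integral 0) UNIV" by simp
  then show ?thesis
    by (rule has_integral_spike[OF K, rotated]) (use FG in auto)
qed

text \<open>The wave equation expresses \<open>S\<close> through second derivatives of the C^2
  function \<open>u\<close>.\<close>

lemma S_continuous: "continuous_on future S"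
proof -
  have "continuous_on future (\<lambda>p. D [e_t, e_t] p - (\<Sum>i\<in>UNIV. D [e_x i, e_x i] p))"
    by (intro continuous_intros D_continuous) (auto simp: e_t_in_Basis e_x_in_Basis)
  then show ?thesis
    by (rule continuous_on_eq) (use wave in \<open>auto simp: box_def D_def\<close>)
qed

lemma M_continuous: "continuous_on (cball 0 T) M"
  unfolding M_def
  by (intro continuous_intros ret_continuous D_continuous) (auto simp: e_t_in_Basis e_x_in_Basis)

lemma kern_continuous: "\<epsilon> > 0 \<Longrightarrow> continuous_on X (kern \<epsilon>)"
  unfolding kern_def by (intro continuous_intros) (auto simp: max_def)

section \<open>Removing the truncation\<close>

lemma integral_identity:
  assumes "\<epsilon> > 0" "\<epsilon> < T"
  shows "(\<lambda>z. ret S z * kern \<epsilon> z) integrable_on cball 0 T"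
    and "integral (cball 0 T) (\<lambda>z. ret S z * kern \<epsilon> z) = integral (cball 0 \<epsilon>) M / \<epsilon> ^ 3"
proof -
  show 1: "(\<lambda>z. ret S z * kern \<epsilon> z) integrable_on cball 0 T"
    by (intro set_lebesgue_integral_eq_integral(1) absolutely_integrable_continuous_compact
        continuous_intros ret_continuous S_continuous kern_continuous assms compact_cball)
  have "continuous_on (cball 0 \<epsilon>) M"
    using M_continuous by (rule continuous_on_subset) (use assms in auto)
  then have 2: "M integrable_on cball 0 \<epsilon>"
    by (intro set_lebesgue_integral_eq_integral(1) absolutely_integrable_continuous_compact compact_cball)
  have "((\<lambda>z. if z \<in> cball 0 \<epsilon> then M z / \<epsilon> ^ 3 else 0) has_integral integral (cball 0 \<epsilon>) M / \<epsilon> ^ 3) UNIV"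
    using has_integral_divide[OF integrable_integral[OF 2]] by (simp only: has_integral_restrict_UNIV)
  moreover have "((\<lambda>z. if z \<in> cball 0 T then ret S z * kern \<epsilon> z else 0) has_integral
      integral (cball 0 T) (\<lambda>z. ret S z * kern \<epsilon> z)) UNIV"
    using integrable_integral[OF 1] by (simp only: has_integral_restrict_UNIV)
  ultimately have "(G \<epsilon> has_integral integral (cball 0 \<epsilon>) M / \<epsilon> ^ 3 - integral (cball 0 T) (\<lambda>z. ret S z * kern \<epsilon> z)) UNIV"
    unfolding G_def[abs_def] mem_cball_0 by (rule has_integral_diff)
  from has_integral_unique[OF this G_integral[OF assms]]
  show "integral (cball 0 T) (\<lambda>z. ret S z * kern \<epsilon> z) = integral (cball 0 \<epsilon>) M / \<epsilon> ^ 3" by simp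
qed

lemma ret_bounded: "\<exists>B\<ge>0. \<forall>z\<in>cball 0 T. \<bar>ret S z\<bar> \<le> B"
proof -
  have "bounded (ret S ` cball 0 T)"
    by (intro compact_imp_bounded compact_continuous_image ret_continuous S_continuous compact_cball)
  then obtain B where "\<forall>z\<in>cball 0 T. \<bar>ret S z\<bar> \<le> B" unfolding bounded_iff by auto
  then have "\<forall>z\<in>cball 0 T. \<bar>ret S z\<bar> \<le> \<bar>B\<bar>" by force
  then show ?thesis by (intro exI[of _ "\<bar>B\<bar>"]) simp
qed

text \<open>In \<open>integral_identity\<close> the radius of truncation tends to 0. The source side
  is dominated by a multiple of \<open>1 / norm z\<close>; the other side tends to
  \<open>4 / 3 * pi * M 0\<close>, and at the vertex \<open>M 0\<close> reduces to
  \<open>3 * u (t0, x0)\<close>.\<close>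

lemma kirchhoff:
  shows "(\<lambda>z. ret S z / norm z) absolutely_integrable_on cball 0 T"
    and "integral (cball 0 T) (\<lambda>z. ret S z / norm z) = 4 * pi * u (t0, x0)"
proof -
  \<comment> \<open>The shift by 2 makes \<open>\<epsilon> k < T\<close> hold already for
    \<open>k = 0\<close>.\<close>
  define \<epsilon> where "\<epsilon> k = T / real (k + 2)" for k
  have \<epsilon>: "\<epsilon> k > 0" "\<epsilon> k < T" for k
    using T_pos by (auto simp: \<epsilon>_def field_simps intro: add_pos_nonneg)
  have \<epsilon>0: "\<epsilon> \<longlonglongrightarrow> 0"
  proof -
    have "(\<lambda>k. T * inverse (real (k + 2))) \<longlonglongrightarrow> T * 0"
      by (intro tendsto_mult tendsto_const LIMSEQ_ignore_initial_segment[OF lim_inverse_n])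
    then show ?thesis unfolding \<epsilon>_def by (simp add: divide_inverse)
  qed
  obtain B where B: "B \<ge> 0" "\<And>z. z \<in> cball 0 T \<Longrightarrow> \<bar>ret S z\<bar> \<le> B" using ret_bounded by blast
  have inv: "(\<lambda>z::real^3. 1 / norm z) integrable_on cball 0 T"
  proof -
    have "(\<lambda>z::real^3. 1 / norm z) absolutely_integrable_on ball 0 (T + 1)"
      by (rule absolutely_integrable_inverse_norm_ball) simp
    then have "(\<lambda>z::real^3. 1 / norm z) absolutely_integrable_on cball 0 T"
      by (rule set_integrable_subset) auto
    then show ?thesis by (rule set_lebesgue_integral_eq_integral(1))
  qed
  have h: "(\<lambda>z::real^3. B * (1 / norm z)) integrable_on cball 0 T"
    by (intro integrable_on_mult_right inv)
  have kern_le: "0 \<le> kern (\<epsilon> k) z \<and> kern (\<epsilon> k) z \<le> 1 / norm z" for k z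
  proof (cases "norm z < \<epsilon> k")
    case True
    show ?thesis
    proof (cases "z = 0")
      case False
      have "norm z ^ 3 \<le> \<epsilon> k ^ 3" using True by (intro power_mono) auto
      then show ?thesis using True False \<epsilon>(1)[of k]
        by (simp add: kern_def max_def min_def field_simps power2_eq_square power3_eq_cube)
    qed (use \<epsilon>(1)[of k] in \<open>simp add: kern_def\<close>)
  next
    case False
    then show ?thesis using \<epsilon>(1)[of k] by (auto simp: kern_def max_def min_def)
  qed
  have le: "norm (ret S z * kern (\<epsilon> k) z) \<le> B * (1 / norm z)" if "z \<in> cball 0 T" for k z
    unfolding norm_mult using B that kern_le[of k z] by (intro mult_mono) auto
  have conv: "(\<lambda>k. ret S z * kern (\<epsilon> k) z) \<longlonglongrightarrow> ret S z / norm z" for z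
  proof (cases "z = 0")
    case True
    \<comment> \<open>At the origin \<open>kern\<close> is zero, and so is the limit because
      division by zero yields zero.\<close>
    then show ?thesis using less_imp_le[OF \<epsilon>(1)] by (simp add: kern_def min_absorb2)
  next
    case False
    have "eventually (\<lambda>k. \<epsilon> k < norm z) sequentially"
      using False by (intro order_tendstoD(2)[OF \<epsilon>0]) simp
    then have "eventually (\<lambda>k. ret S z * kern (\<epsilon> k) z = ret S z / norm z) sequentially"
      by eventually_elim (use \<epsilon>(1) in \<open>auto simp: kern_def max_def min_def less_imp_neq[symmetric]\<close>)
    then show ?thesis by (rule tendsto_eventually)
  qed
  note dc = dominated_convergence[OF integral_identity(1)[OF \<epsilon>] h le conv]
  have "norm (ret S z / norm z) \<le> B * (1 / norm z)" if "z \<in> cball 0 T" for z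
    using B(2)[OF that] by (simp add: divide_right_mono)
  then show "(\<lambda>z. ret S z / norm z) absolutely_integrable_on cball 0 T"
    using dc(1) h by (intro absolutely_integrable_integrable_bound[of _ _ "\<lambda>z. B * (1 / norm z)"]) auto
  have "(\<lambda>k. integral (cball 0 (\<epsilon> k)) M / \<epsilon> k ^ 3) \<longlonglongrightarrow> 4 / 3 * pi * M 0"
    by (rule integral_cball_average[OF T_pos M_continuous]) (use \<epsilon> \<epsilon>0 in \<open>auto simp: less_imp_le\<close>)
  then have "(\<lambda>k. integral (cball 0 T) (\<lambda>z. ret S z * kern (\<epsilon> k) z)) \<longlonglongrightarrow> 4 / 3 * pi * M 0"
    unfolding integral_identity(2)[OF \<epsilon>] .
  then have "integral (cball 0 T) (\<lambda>z. ret S z / norm z) = 4 / 3 * pi * M 0"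
    using dc(2) LIMSEQ_unique by blast
  then show "integral (cball 0 T) (\<lambda>z. ret S z / norm z) = 4 * pi * u (t0, x0)"
    by (simp add: M_def ret_def D_def)
qed

end

section \<open>Velocities as coordinates on the backward cone\<close>

lemma has_absolute_integral_change_of_variables_scalar:
  fixes f :: "real^'m::{finite,wellorder} \<Rightarrow> real" and g :: "real^'m::_ \<Rightarrow> real^'m::_"
  assumes "S \<in> sets lebesgue"
    and "\<And>x. x \<in> S \<Longrightarrow> (g has_derivative g' x) (at x within S)"
    and "inj_on g S"
  shows "(\<lambda>x. \<bar>det (matrix (g' x))\<bar> * f (g x)) absolutely_integrable_on S \<and>
           integral S (\<lambda>x. \<bar>det (matrix (g' x))\<bar> * f (g x)) = b
     \<longleftrightarrow> f absolutely_integrable_on (g ` S) \<and> integral (g ` S) f = b"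
proof -
  let ?v = "vec :: real \<Rightarrow> real^1"
  have "(\<lambda>x. \<bar>det (matrix (g' x))\<bar> *\<^sub>R ?v (f (g x))) = (\<lambda>x. ?v (\<bar>det (matrix (g' x))\<bar> * f (g x)))"
    by (simp add: fun_eq_iff vec_eq_iff)
  moreover have "h absolutely_integrable_on X \<and> integral X h = c \<longleftrightarrow>
      (\<lambda>x. ?v (h x)) absolutely_integrable_on X \<and> integral X (\<lambda>x. ?v (h x)) = ?v c"
    for h :: "real^'m::_ \<Rightarrow> real" and X c
  proof -
    have a: "h absolutely_integrable_on X \<longleftrightarrow> (\<lambda>x. ?v (h x)) absolutely_integrable_on X"
      by (simp add: absolutely_integrable_on_1_iff)
    have "integral X (\<lambda>x. ?v (h x)) = ?v (integral X h)"
      if "h absolutely_integrable_on X"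
      using that by (simp add: integral_on_1_eq vec_eq_iff)
    then show ?thesis using a by (auto simp: vec_eq_iff)
  qed
  ultimately show ?thesis
    using has_absolute_integral_change_of_variables[OF assms, of "\<lambda>x. ?v (f x)" "?v b"] by simp
qed

text \<open>The matrix is \<open>c\<close> times the identity plus a matrix of rank one: the
  eigenvalue \<open>c\<close> counts twice, and the remaining one is
  \<open>c + n \<bullet> w\<close>.\<close>

lemma det_matrix_rank_one_update:
  fixes n w :: "real^3"
  shows "det (matrix (\<lambda>h. c *\<^sub>R h + (n \<bullet> h) *\<^sub>R w)) = c\<^sup>2 * (c + n \<bullet> w)"
  unfolding det_3 matrix_def
  by (simp add: axis_def inner_vec_def sum_3 algebra_simps power2_eq_square power3_eq_cube)

text \<open>
  The points \<open>(t - |z|, x + z)\<close> are those of the backward light cone of \<open>(t, x)\<close>;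
  \<open>cone_velocity\<close> labels such a point by the charge worldline through the origin that meets the cone
  there, and \<open>cone_section\<close> collects the \<open>z\<close> for which this worldline is timelike.
\<close>

definition cone_velocity :: "real \<Rightarrow> real^3 \<Rightarrow> real^3 \<Rightarrow> real^3" where
  "cone_velocity t x z = inverse (t - norm z) *\<^sub>R (x + z)"

definition cone_section :: "real \<Rightarrow> real^3 \<Rightarrow> (real^3) set" where
  "cone_section t x = {z. z \<noteq> 0 \<and> norm (x + z) < t - norm z}"

text \<open>The worldline \<open>s *\<^sub>R y\<close> meets the light cone of \<open>(t, x)\<close>
  at the roots of a quadratic in \<open>s\<close>; the radicand is a quarter of its
  discriminant.\<close>

definition denom :: "real \<Rightarrow> real^3 \<Rightarrow> real^3 \<Rightarrow> real" where
  "denom t x y = sqrt ((t - x \<bullet> y)\<^sup>2 - (t\<^sup>2 - (norm x)\<^sup>2) * (1 - (norm y)\<^sup>2))"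

lemma cone_section_pos: "z \<in> cone_section t x \<Longrightarrow> t - norm z > 0 \<and> norm z > 0"
  unfolding cone_section_def using norm_ge_zero[of "x + z"] by (auto simp del: norm_ge_zero)

lemma norm_cone_velocity:
  assumes "z \<in> cone_section t x"
  shows "norm (cone_velocity t x z) < 1"
proof -
  have "norm (cone_velocity t x z) = norm (x + z) / (t - norm z)"
    using cone_section_pos[OF assms] by (simp add: cone_velocity_def divide_inverse del: scaleR_add_right)
  then show ?thesis using assms cone_section_pos[OF assms] by (simp add: cone_section_def)
qed

lemma cone_velocity_derivative:
  assumes "z \<in> cone_section t x"
  shows "(cone_velocity t x has_derivative (\<lambda>h. inverse (t - norm z) *\<^sub>R h +
     ((inverse (norm z) *\<^sub>R z) \<bullet> h) *\<^sub>R (inverse (t - norm z) *\<^sub>R cone_velocity t x z))) (at z)"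
proof -
  have pos: "t - norm z \<noteq> 0" "z \<noteq> 0" using cone_section_pos[OF assms] by auto
  have "((\<lambda>z. inverse (t - norm z) *\<^sub>R (x + z)) has_derivative
     (\<lambda>h. inverse (t - norm z) *\<^sub>R h + (inverse (t - norm z) * (sgn z \<bullet> h) * inverse (t - norm z)) *\<^sub>R (x + z))) (at z)"
    by (rule derivative_eq_intros has_derivative_norm refl pos)+ (simp add: fun_eq_iff inner_commute)
  then show ?thesis
    unfolding cone_velocity_def[abs_def]
    by (rule has_derivative_eq_rhs) (simp add: fun_eq_iff sgn_div_norm mult_ac)
qed

text \<open>In this Jacobian \<open>(t - norm z) ^ 3\<close> matches the homogeneity of the source
  and \<open>norm z\<close> the Kirchhoff kernel, so the numerator is all that remains after the
  change of variables, as a denominator.\<close>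

lemma cone_velocity_det:
  assumes "z \<in> cone_section t x"
  shows "det (matrix (\<lambda>h. inverse (t - norm z) *\<^sub>R h +
     ((inverse (norm z) *\<^sub>R z) \<bullet> h) *\<^sub>R (inverse (t - norm z) *\<^sub>R cone_velocity t x z)))
    = (norm z + z \<bullet> cone_velocity t x z) / ((t - norm z) ^ 3 * norm z)"
proof -
  have "(inverse s)\<^sup>2 * (inverse s + inverse s * (inverse n * v)) = (n + v) / (s ^ 3 * n)"
    if "s > 0" "n > 0" for s n v :: real
    using that by (simp add: field_simps power2_eq_square power3_eq_cube)
  from this[of "t - norm z" "norm z" "z \<bullet> cone_velocity t x z"] cone_section_pos[OF assms]
  show ?thesis unfolding det_matrix_rank_one_update by (simp only: inner_scaleR_left inner_scaleR_right)
qed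

text \<open>Substituting \<open>x = s *\<^sub>R y - z\<close> and \<open>t = s + norm z\<close>
  turns the radicand into a perfect square. Its root is positive by Cauchy-Schwarz, as the speed is
  below 1.\<close>

lemma denom_cone_velocity:
  assumes "z \<in> cone_section t x"
  shows "denom t x (cone_velocity t x z) = norm z + z \<bullet> cone_velocity t x z"
    and "norm z + z \<bullet> cone_velocity t x z > 0"
proof -
  define y s where "y = cone_velocity t x z" and "s = t - norm z"
  have pos: "s > 0" "norm z > 0" using cone_section_pos[OF assms] by (auto simp: s_def)
  have y: "norm y < 1" using norm_cone_velocity[OF assms] by (simp add: y_def)
  have x: "x = s *\<^sub>R y - z" using pos by (simp add: y_def cone_velocity_def s_def)
  have "\<bar>z \<bullet> y\<bar> \<le> norm z * norm y" by (rule Cauchy_Schwarz_ineq2)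
  also have "\<dots> < norm z" using y pos by simp
  finally show p: "norm z + z \<bullet> cone_velocity t x z > 0" by (auto simp: y_def[symmetric])
  have ny: "(norm y)\<^sup>2 = y \<bullet> y" and nz: "(norm z)\<^sup>2 = z \<bullet> z" by (simp_all add: power2_norm_eq_inner)
  have nx: "(norm x)\<^sup>2 = s\<^sup>2 * (norm y)\<^sup>2 - 2 * s * (z \<bullet> y) + (norm z)\<^sup>2"
    unfolding ny nz unfolding x power2_norm_eq_inner
    by (simp add: inner_diff inner_commute algebra_simps power2_eq_square)
  have xy: "x \<bullet> y = s * (norm y)\<^sup>2 - z \<bullet> y" unfolding ny unfolding x by (simp add: inner_diff)
  have t: "t = s + norm z" by (simp add: s_def)
  have "(t - x \<bullet> y)\<^sup>2 - (t\<^sup>2 - (norm x)\<^sup>2) * (1 - (norm y)\<^sup>2) = (norm z + z \<bullet> y)\<^sup>2"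
    unfolding nx xy t by (simp add: algebra_simps power2_eq_square)
  then show "denom t x (cone_velocity t x z) = norm z + z \<bullet> cone_velocity t x z"
    using p unfolding denom_def y_def[symmetric] by simp
qed

text \<open>The function \<open>t - s - norm (s *\<^sub>R y - x)\<close> is strictly decreasing
  because \<open>norm y < 1\<close>, and it changes sign between \<open>0\<close> and
  \<open>t\<close>. The second disjunct is the worldline through the vertex itself.\<close>

lemma ray_meets_cone:
  fixes x y :: "real^3"
  assumes "norm x < t" "norm y < 1"
  shows "\<exists>!s. s < t \<and> norm (s *\<^sub>R y - x) = t - s \<or> s = t \<and> t *\<^sub>R y = x"
proof -
  define k where "k s = t - s - norm (s *\<^sub>R y - x)" for s
  have root: "(s < t \<and> norm (s *\<^sub>R y - x) = t - s \<or> s = t \<and> t *\<^sub>R y = x) \<longleftrightarrow> k s = 0" for s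
    using norm_ge_zero[of "s *\<^sub>R y - x"] unfolding k_def by (cases "s = t") (auto simp del: norm_ge_zero)
  have mono: "k s' < k s" if "s < s'" for s s'
  proof -
    have "norm (s *\<^sub>R y - x) \<le> norm (s' *\<^sub>R y - x) + norm ((s' - s) *\<^sub>R y)"
      using norm_triangle_ineq4[of "s' *\<^sub>R y - x" "(s' - s) *\<^sub>R y"] by (simp add: algebra_simps)
    moreover have "norm ((s' - s) *\<^sub>R y) < s' - s"
      using that assms(2) by simp
    ultimately show ?thesis by (simp add: k_def)
  qed
  have "\<exists>s\<ge>0. s \<le> t \<and> k s = 0"
  proof (rule IVT2')
    show "k t \<le> 0" "0 \<le> k 0" using assms by (auto simp: k_def)
    show "0 \<le> t" using assms(1) norm_ge_zero[of x] by linarith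
    show "continuous_on {0..t} k" unfolding k_def by (intro continuous_intros)
  qed
  then obtain s where "k s = 0" by blast
  then show ?thesis
    unfolding root by (intro ex1I[of _ s]) (auto, metis less_irrefl linorder_less_linear mono)
qed

lemma cone_velocity_bij:
  assumes "norm x < t"
  shows "inj_on (cone_velocity t x) (cone_section t x)"
    and "cone_velocity t x ` cone_section t x = ball 0 1 - {inverse t *\<^sub>R x}"
proof -
  have t: "t > 0" using assms norm_ge_zero[of x] by linarith
  have root: "norm ((t - norm z) *\<^sub>R cone_velocity t x z - x) = norm z \<and> t - norm z < t"
    and ray: "z = (t - norm z) *\<^sub>R cone_velocity t x z - x" if "z \<in> cone_section t x" for z
    using cone_section_pos[OF that] by (auto simp: cone_velocity_def)
  show inj: "inj_on (cone_velocity t x) (cone_section t x)"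
  proof (rule inj_onI)
    fix z w assume z: "z \<in> cone_section t x" and w: "w \<in> cone_section t x"
      and eq: "cone_velocity t x z = cone_velocity t x w"
    have "t - norm z = t - norm w"
      using ray_meets_cone[OF assms norm_cone_velocity[OF z]] root[OF z] root[OF w] eq
      by (metis diff_diff_eq2 add_diff_cancel_left')
    then show "z = w" using ray[OF z] ray[OF w] eq by metis
  qed
  show "cone_velocity t x ` cone_section t x = ball 0 1 - {inverse t *\<^sub>R x}"
  proof (intro equalityI subsetI)
    fix y assume "y \<in> cone_velocity t x ` cone_section t x"
    then obtain z where z: "z \<in> cone_section t x" "y = cone_velocity t x z" by blast
    have "y \<noteq> inverse t *\<^sub>R x"
    proof
      assume "y = inverse t *\<^sub>R x"
      then have ty: "t *\<^sub>R y = x" using t by simp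
      have "t - norm z = t"
        using ray_meets_cone[OF assms norm_cone_velocity[OF z(1)]] root[OF z(1)] ty z(2)
        by (metis diff_diff_eq2 add_diff_cancel_left')
      then show False using cone_section_pos[OF z(1)] by simp
    qed
    then show "y \<in> ball 0 1 - {inverse t *\<^sub>R x}"
      using norm_cone_velocity[OF z(1)] z(2) by simp
  next
    fix y assume y: "y \<in> ball 0 1 - {inverse t *\<^sub>R x}"
    then have ny: "norm y < 1" and ne: "t *\<^sub>R y \<noteq> x" using t by auto
    obtain s where s: "s < t" "norm (s *\<^sub>R y - x) = t - s"
      using ray_meets_cone[OF assms ny] ne by blast
    \<comment> \<open>\<open>cone_velocity\<close> divides by this time. The point
      \<open>(t, x)\<close> lies inside the future cone of the origin, so no charge meets its
      backward cone at or before time 0.\<close>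
    have s0: "s > 0"
    proof (rule ccontr)
      assume "\<not> s > 0"
      then have "norm (s *\<^sub>R y - x) \<le> norm x + \<bar>s\<bar> * norm y"
        using norm_triangle_ineq4[of "s *\<^sub>R y" x] by simp
      also have "\<dots> \<le> norm x + \<bar>s\<bar>" using ny by (simp add: mult_left_le)
      also have "\<dots> < t - s" using assms \<open>\<not> s > 0\<close> by simp
      finally show False using s by simp
    qed
    define z where "z = s *\<^sub>R y - x"
    have z: "norm z = t - s" using s by (simp add: z_def)
    have "z \<in> cone_section t x"
      unfolding cone_section_def using z s(1) s0 ny by (auto simp: z_def)
    moreover have "cone_velocity t x z = y"
      unfolding cone_velocity_def z using s0 by (simp add: z_def)
    ultimately show "y \<in> cone_velocity t x ` cone_section t x" by blast
  qed
qed

lemma cone_section_measurable: "cone_section t x \<in> sets lebesgue"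
proof -
  have "open ({z. norm (x + z) < t - norm z} - {0})"
    by (intro open_Diff open_Collect_less continuous_intros)
  moreover have "cone_section t x = {z. norm (x + z) < t - norm z} - {0}" by (auto simp: cone_section_def)
  ultimately show ?thesis by (simp add: borel_open)
qed

text \<open>The potential is a superposition of boosted Coulomb potentials, one for each velocity \<open>y\<close>.\<close>

lemma (in cauchy_problem) lienard_wiechert:
  assumes S: "\<And>p. p \<in> future \<Longrightarrow>
      S p = (if norm (snd p) < fst p then k (vel p) / fst p ^ 3 else 0)"
    and far: "t0 - norm x0 \<ge> 4"
  shows "(\<lambda>y. k y / denom t0 x0 y) absolutely_integrable_on ball 0 1"
    and "integral (ball 0 1) (\<lambda>y. k y / denom t0 x0 y) = 4 * pi * u (t0, x0)"
proof -
  let ?E = "cone_section t0 x0" and ?\<Phi> = "cone_velocity t0 x0"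
  let ?F = "\<lambda>y. k y / denom t0 x0 y"
  let ?D = "\<lambda>z h. inverse (t0 - norm z) *\<^sub>R h +
     ((inverse (norm z) *\<^sub>R z) \<bullet> h) *\<^sub>R (inverse (t0 - norm z) *\<^sub>R ?\<Phi> z)"
  have nx: "norm x0 < t0" using far by simp
  \<comment> \<open>The triangle inequality gives \<open>2 * norm z < t0 + norm x0\<close>, and
    \<open>t0 - norm x0 \<ge> 4\<close> turns this into \<open>norm z < t0 - 2\<close>.\<close>
  have sub: "z \<in> cball 0 T" if "norm (x0 + z) < t0 - norm z" for z
  proof -
    have "norm z \<le> norm (x0 + z) + norm x0" using norm_triangle_ineq4[of "x0 + z" x0] by simp
    then show ?thesis using that far by (simp add: T_def)
  qed
  have integrand: "(if z \<in> cball 0 T then ret S z / norm z else 0) =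
      (if z \<in> ?E then \<bar>det (matrix (?D z))\<bar> * ?F (?\<Phi> z) else 0)" for z
  proof (cases "z \<in> ?E")
    case True
    have zT: "z \<in> cball 0 T" using True sub by (simp add: cone_section_def)
    note pos = cone_section_pos[OF True] denom_cone_velocity[OF True]
    have "ret S z = k (?\<Phi> z) / (t0 - norm z) ^ 3"
      unfolding ret_def using S[OF ret_maps[of z]] zT True
      by (simp add: cone_section_def vel_def cone_velocity_def)
    moreover have "\<bar>det (matrix (?D z))\<bar> = (norm z + z \<bullet> ?\<Phi> z) / ((t0 - norm z) ^ 3 * norm z)"
      unfolding cone_velocity_det[OF True] using pos by (intro abs_of_pos divide_pos_pos mult_pos_pos) auto
    ultimately have "ret S z / norm z = \<bar>det (matrix (?D z))\<bar> * ?F (?\<Phi> z)"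
      using pos by simp
    then show ?thesis using zT True by presburger
  next
    case False
    then have "ret S z / norm z = 0" if "z \<in> cball 0 T"
      using S[OF ret_maps[of z]] that by (auto simp: ret_def cone_section_def)
    then show ?thesis using False by auto
  qed
  have "(\<lambda>z. if z \<in> cball 0 T then ret S z / norm z else 0) absolutely_integrable_on UNIV"
    "integral UNIV (\<lambda>z. if z \<in> cball 0 T then ret S z / norm z else 0) = 4 * pi * u (t0, x0)"
    using kirchhoff by (simp_all only: absolutely_integrable_restrict_UNIV integral_restrict_UNIV)
  then have "(\<lambda>z. \<bar>det (matrix (?D z))\<bar> * ?F (?\<Phi> z)) absolutely_integrable_on ?E \<and>
      integral ?E (\<lambda>z. \<bar>det (matrix (?D z))\<bar> * ?F (?\<Phi> z)) = 4 * pi * u (t0, x0)"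
    unfolding integrand by (simp only: absolutely_integrable_restrict_UNIV integral_restrict_UNIV)
  then have F: "?F absolutely_integrable_on (?\<Phi> ` ?E)" "integral (?\<Phi> ` ?E) ?F = 4 * pi * u (t0, x0)"
    using has_absolute_integral_change_of_variables_scalar[OF cone_section_measurable
        has_derivative_at_withinI[OF cone_velocity_derivative] cone_velocity_bij(1)[OF nx]]
    by blast+
  \<comment> \<open>The image of the cone section and the unit ball differ only in the velocity of
    the charge that passes through the vertex.\<close>
  have neg: "negligible {y \<in> X - Y. ?F y \<noteq> 0}"
    if "X \<subseteq> ball 0 1" "ball 0 1 - {inverse t0 *\<^sub>R x0} \<subseteq> Y" for X Y
    by (rule negligible_subset[of "{inverse t0 *\<^sub>R x0}"]) (use that in auto)
  show "integral (ball 0 1) ?F = 4 * pi * u (t0, x0)"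
    unfolding F(2)[symmetric] cone_velocity_bij(2)[OF nx]
    by (intro integral_spike_set neg) auto
  show "?F absolutely_integrable_on ball 0 1"
    using F(1) unfolding cone_velocity_bij(2)[OF nx]
    by (rule absolutely_integrable_spike_set) (intro neg; auto)+
qed

section \<open>Approach to null infinity\<close>

text \<open>The point is that \<open>C\<close> does not depend on \<open>w\<close>, which controls a
  moving singularity uniformly. Radius 2 makes the ball around any \<open>w\<close> with
  \<open>norm w < 1\<close> contain the unit ball.\<close>

lemma has_integral_inverse_dist:
  fixes w :: "real^3"
  defines "C \<equiv> integral (ball 0 2) (\<lambda>z::real^3. 1 / norm z)"
  shows "((\<lambda>y. if y \<in> ball w 2 then 1 / norm (y - w) else 0) has_integral C) UNIV"
proof -
  let ?f = "\<lambda>z::real^3. if z \<in> ball 0 2 then 1 / norm z else 0"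
  have i: "(\<lambda>z::real^3. 1 / norm z) absolutely_integrable_on ball 0 2"
    by (rule absolutely_integrable_inverse_norm_ball) simp
  have f: "?f absolutely_integrable_on UNIV" "integral UNIV ?f = C"
    using i by (simp_all only: C_def absolutely_integrable_restrict_UNIV integral_restrict_UNIV)
  have range: "range (\<lambda>y::real^3. y - w) = UNIV" by (rule surjI[of _ "\<lambda>y. y + w"]) simp
  have der: "((\<lambda>y. y - w) has_derivative (\<lambda>h. h)) (at y)" for y
    by (auto intro!: derivative_eq_intros)
  have "matrix (\<lambda>h::real^3. h) = mat 1" by (simp add: matrix_def mat_def axis_def vec_eq_iff)
  then have "(\<lambda>y. ?f (y - w)) absolutely_integrable_on UNIV \<and> integral UNIV (\<lambda>y. ?f (y - w)) = C"
    using has_absolute_integral_change_of_variables_scalar[of UNIV "\<lambda>y. y - w" "\<lambda>_ h. h" ?f C] f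
    unfolding range by (simp add: inj_on_def der)
  then have "((\<lambda>y. ?f (y - w)) has_integral C) UNIV"
    using set_lebesgue_integral_eq_integral(1) has_integral_iff by blast
  moreover have "(\<lambda>y. ?f (y - w)) = (\<lambda>y. if y \<in> ball w 2 then 1 / norm (y - w) else 0)"
    by (simp add: fun_eq_iff dist_norm norm_minus_commute)
  ultimately show ?thesis by simp
qed

section \<open>Bounds for a single charge, with d = t - r\<close>

definition angular_gap :: "real^3 \<Rightarrow> real^3 \<Rightarrow> real" where
  "angular_gap x y = 1 - (x /\<^sub>R norm x) \<bullet> y"

locale retarded_charge =
  fixes x y :: "real^3" and d :: real
  assumes x: "x \<noteq> 0" and y: "norm y < 1" and d: "d > 0"
begin

abbreviation "r \<equiv> norm x"
abbreviation "t \<equiv> norm x + d"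
abbreviation "a \<equiv> angular_gap x y"
abbreviation "b \<equiv> 1 - (norm y)\<^sup>2"

lemma gap_ge: "1 - norm y \<le> a"
proof -
  have "\<bar>(x /\<^sub>R norm x) \<bullet> y\<bar> \<le> norm (x /\<^sub>R norm x) * norm y" by (rule Cauchy_Schwarz_ineq2)
  also have "\<dots> = norm y" using x by simp
  finally show ?thesis by (simp add: angular_gap_def)
qed

lemma a_pos: "a > 0" using gap_ge y by simp

lemma xy: "x \<bullet> y = r * (1 - a)"
  using x by (simp add: angular_gap_def)

lemma denom_eq: "denom t x y = sqrt ((r * a + d)\<^sup>2 - (2 * r * d + d\<^sup>2) * b)"
  unfolding denom_def xy by (simp add: algebra_simps power2_eq_square)

lemma b_bounds: "0 < b" "b \<le> 1" "b \<le> 2 * a - a\<^sup>2"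
proof -
  have "(norm y)\<^sup>2 < 1" using y by (simp add: power_less_one_iff)
  then show "0 < b" "b \<le> 1" by auto
  have "\<bar>1 - a\<bar> \<le> norm (x /\<^sub>R norm x) * norm y"
    unfolding angular_gap_def using Cauchy_Schwarz_ineq2[of "x /\<^sub>R norm x" y] by simp
  also have "\<dots> = norm y" using x by simp
  finally have "(1 - a)\<^sup>2 \<le> (norm y)\<^sup>2" by (metis abs_le_square_iff abs_norm_cancel)
  then show "b \<le> 2 * a - a\<^sup>2" by (simp add: power2_eq_square algebra_simps)
qed

text \<open>The bound \<open>b \<le> 2 * a - a\<^sup>2\<close> completes the square: the radicand is
  at least \<open>(r * a - d * (1 - a))\<^sup>2\<close>.\<close>

lemma denom_ge_far: "r * a - d \<le> denom t x y"
proof -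
  have r: "r > 0" using x by simp
  have "(2 * r * d + d\<^sup>2) * b \<le> (2 * r * d + d\<^sup>2) * (2 * a - a\<^sup>2)"
    using b_bounds r d by (intro mult_left_mono) auto
  then have "(r * a - d * (1 - a))\<^sup>2 \<le> (r * a + d)\<^sup>2 - (2 * r * d + d\<^sup>2) * b"
    by (simp add: power2_eq_square algebra_simps)
  then have "\<bar>r * a - d * (1 - a)\<bar> \<le> denom t x y"
    unfolding denom_eq by (rule real_le_rsqrt[of "\<bar>_\<bar>", unfolded power2_abs])
  moreover have "d * (1 - a) \<le> d * 1" using a_pos d by (intro mult_left_mono) auto
  ultimately show ?thesis by (simp add: abs_le_iff)
qed

text \<open>Subtracting the square of the left-hand side from the radicand leaves the square of
  \<open>t * (m - \<beta>)\<close>, in the notation of the proof.\<close>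

lemma denom_ge_near: "sqrt (2 * r * d + d\<^sup>2) * norm (y - x /\<^sub>R t) \<le> denom t x y"
proof -
  have r: "r > 0" using x by simp
  define t where "t = r + d"
  have t: "t = r + d" by (simp add: t_def)
  have t0: "t > 0" using r d unfolding t_def by linarith
  define \<beta> m where "\<beta> = (r / t)\<^sup>2" and "m = x \<bullet> y / t"
  have n: "(norm (y - x /\<^sub>R t))\<^sup>2 = (norm y)\<^sup>2 - 2 * m + \<beta>"
    unfolding power2_norm_eq_inner \<beta>_def m_def power_divide
    by (simp add: inner_diff inner_commute divide_inverse power2_norm_eq_inner power2_eq_square)
  have rt: "2 * r * d + d\<^sup>2 = t\<^sup>2 * (1 - \<beta>)"
  proof -
    have "t\<^sup>2 * (1 - \<beta>) = t\<^sup>2 - r\<^sup>2" using t0 by (simp add: \<beta>_def power_divide right_diff_distrib)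
    then show ?thesis by (simp add: t power2_eq_square algebra_simps)
  qed
  have "(r * a + d)\<^sup>2 = (t * (1 - m))\<^sup>2"
  proof -
    have "t * (1 - m) = t - x \<bullet> y" using t0 by (simp add: m_def right_diff_distrib)
    then have "r * a + d = t * (1 - m)" by (simp add: xy t algebra_simps)
    then show ?thesis by simp
  qed
  then have "(r * a + d)\<^sup>2 - (2 * r * d + d\<^sup>2) * b - (2 * r * d + d\<^sup>2) * (norm (y - x /\<^sub>R t))\<^sup>2
      = t\<^sup>2 * (m - \<beta>)\<^sup>2"
    unfolding n rt by (simp add: power2_eq_square algebra_simps)
  then have "(2 * r * d + d\<^sup>2) * (norm (y - x /\<^sub>R t))\<^sup>2 \<le> (r * a + d)\<^sup>2 - (2 * r * d + d\<^sup>2) * b"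
    by (metis diff_ge_0_iff_ge zero_le_mult_iff zero_le_power2)
  then show ?thesis
    unfolding t[symmetric] denom_eq[folded t] using r d by (intro real_le_rsqrt) (simp add: power_mult_distrib)
qed

lemma denom_eq_0: "y = x /\<^sub>R t \<Longrightarrow> denom t x y = 0"
proof -
  assume yx: "y = x /\<^sub>R t"
  have "r > 0" using x by simp
  then have t: "t > 0" using d by linarith
  have "x \<bullet> y = r\<^sup>2 / t" "(norm y)\<^sup>2 = r\<^sup>2 / t\<^sup>2"
    by (simp_all add: yx dot_square_norm power_mult_distrib divide_inverse power_inverse mult.commute)
  moreover have "(s - \<rho> / s)\<^sup>2 - (s\<^sup>2 - \<rho>) * (1 - \<rho> / s\<^sup>2) = 0" if "s > 0" for s \<rho> :: real
    using that by (simp add: field_simps power2_eq_square)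
  ultimately show ?thesis unfolding denom_def using t by simp
qed

lemma ratio_far: "r * a \<ge> 2 * d \<Longrightarrow> 0 \<le> r * a / denom t x y \<and> r * a / denom t x y \<le> 2"
  using denom_ge_far d by (auto simp: field_simps)

lemma ratio_near:
  assumes "r * a < 2 * d"
  shows "\<bar>r * a / denom t x y\<bar> \<le> 2 * d / sqrt (2 * r * d + d\<^sup>2) * (1 / norm (y - x /\<^sub>R t))"
proof (cases "y = x /\<^sub>R t")
  case True
  \<comment> \<open>At the singular velocity the quotient is zero, since its denominator
    vanishes.\<close>
  have "denom t x y = 0" using True by (rule denom_eq_0)
  moreover have "0 \<le> 2 * d / sqrt (2 * r * d + d\<^sup>2) * (1 / norm (y - x /\<^sub>R t))"
    using d by (intro mult_nonneg_nonneg divide_nonneg_nonneg real_sqrt_ge_zero add_nonneg_nonneg) auto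
  ultimately show ?thesis by simp
next
  case False
  have "r > 0" using x by simp
  then have "sqrt (2 * r * d + d\<^sup>2) * norm (y - x /\<^sub>R t) > 0" using False d by (simp add: add_pos_pos)
  moreover from this have "denom t x y > 0" using denom_ge_near by linarith
  moreover have "0 \<le> r * a" using \<open>r > 0\<close> a_pos by simp
  ultimately have "r * a / denom t x y \<le> 2 * d / (sqrt (2 * r * d + d\<^sup>2) * norm (y - x /\<^sub>R t))"
    using assms denom_ge_near by (intro frac_le) auto
  moreover have "0 \<le> r * a / denom t x y" using \<open>denom t x y > 0\<close> \<open>0 \<le> r * a\<close> by simp
  ultimately show ?thesis by simp
qed

end

text \<open>Dividing the radicand by \<open>(r n * a n)\<^sup>2\<close> leaves \<open>Q n\<close>,
  which tends to 1. The gap \<open>a n\<close> may oscillate with the direction of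
  \<open>X n\<close>; its lower bound \<open>\<kappa> = 1 - norm y\<close> suffices.\<close>

lemma ratio_tendsto:
  fixes X :: "nat \<Rightarrow> real^3"
  assumes X: "\<And>n. X n \<noteq> 0" "filterlim (\<lambda>n. norm (X n)) at_top sequentially"
    and y: "norm y < 1" and d: "d > 0"
  shows "(\<lambda>n. norm (X n) * angular_gap (X n) y / denom (norm (X n) + d) (X n) y) \<longlonglongrightarrow> 1"
proof -
  define r a where "r n = norm (X n)" and "a n = angular_gap (X n) y" for n
  define b where "b = 1 - (norm y)\<^sup>2"
  define \<kappa> where "\<kappa> = 1 - norm y"
  have \<kappa>: "\<kappa> > 0" using y by (simp add: \<kappa>_def)
  have rc: "retarded_charge (X n) y d" for n using X(1) y d by unfold_locales
  have r: "r n > 0" for n using X by (simp add: r_def)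
  have a: "a n \<ge> \<kappa>" for n
    using retarded_charge.gap_ge[OF rc] by (simp add: a_def \<kappa>_def)
  then have a0: "a n > 0" for n using \<kappa> by (rule less_le_trans[rotated])
  have b: "0 < b" "b \<le> 1" using retarded_charge.b_bounds(1,2)[OF rc] by (simp_all add: b_def)
  have rinv: "(\<lambda>n. inverse (r n)) \<longlonglongrightarrow> 0"
    unfolding r_def by (rule tendsto_inverse_0_at_top[OF X(2)])
  have ainv: "inverse (a n) \<le> inverse \<kappa>" for n using a \<kappa> by (intro le_imp_inverse_le) auto
  have c: "(\<lambda>n. inverse (r n) * inverse (a n)) \<longlonglongrightarrow> 0"
  proof (rule tendsto_sandwich[of "\<lambda>_. 0" _ _ "\<lambda>n. inverse (r n) * inverse \<kappa>"])
    show "(\<lambda>n. inverse (r n) * inverse \<kappa>) \<longlonglongrightarrow> 0" using tendsto_mult_left_zero[OF rinv] .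
  qed (use r a0 ainv in \<open>auto intro!: always_eventually mult_left_mono less_imp_le\<close>)
  have e: "(\<lambda>n. inverse (a n) * b * (inverse (r n) * inverse (a n))) \<longlonglongrightarrow> 0"
  proof (rule tendsto_sandwich[of "\<lambda>_. 0" _ _ "\<lambda>n. inverse \<kappa> * (inverse (r n) * inverse (a n))"])
    show "(\<lambda>n. inverse \<kappa> * (inverse (r n) * inverse (a n))) \<longlonglongrightarrow> 0"
      using tendsto_mult_right_zero[OF c] .
    have "inverse (a n) * b \<le> inverse \<kappa> * 1" for n using ainv b a0 \<kappa> by (intro mult_mono) (auto intro: less_imp_le)
    then show "\<forall>\<^sub>F n in sequentially. inverse (a n) * b * (inverse (r n) * inverse (a n))
        \<le> inverse \<kappa> * (inverse (r n) * inverse (a n))"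
      using r a0 by (intro always_eventually allI mult_right_mono) (auto intro: less_imp_le)
  qed (use r a0 b in \<open>auto intro!: always_eventually less_imp_le\<close>)
  define Q where "Q n = (1 + d * (inverse (r n) * inverse (a n)))\<^sup>2
      - (2 * d + d\<^sup>2 * inverse (r n)) * (inverse (a n) * b * (inverse (r n) * inverse (a n)))" for n
  have "Q \<longlonglongrightarrow> (1 + d * 0)\<^sup>2 - (2 * d + d\<^sup>2 * 0) * 0"
    unfolding Q_def by (intro tendsto_intros c e rinv)
  then have "(\<lambda>n. 1 / sqrt (Q n)) \<longlonglongrightarrow> 1 / sqrt 1"
    by (intro tendsto_divide tendsto_real_sqrt tendsto_const) auto
  moreover have "r n * a n / denom (r n + d) (X n) y = 1 / sqrt (Q n)" for n
  proof -
    have "(r n * a n + d)\<^sup>2 - (2 * r n * d + d\<^sup>2) * b = (r n * a n)\<^sup>2 * Q n"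
      unfolding Q_def using r[of n] a0[of n] by (simp add: field_simps power2_eq_square)
    then have "denom (r n + d) (X n) y = r n * a n * sqrt (Q n)"
      using retarded_charge.denom_eq[OF rc, of n] r[of n] a0[of n]
      by (simp add: r_def[symmetric] a_def[symmetric] b_def[symmetric] real_sqrt_mult)
    then show ?thesis using r[of n] a0[of n] by simp
  qed
  ultimately show ?thesis by (simp add: r_def a_def)
qed

lemma charge_limit:
  fixes X :: "nat \<Rightarrow> real^3" and g :: "real^3 \<Rightarrow> real"
  assumes X: "\<And>n. X n \<noteq> 0" "filterlim (\<lambda>n. norm (X n)) at_top sequentially"
    and d: "d > 0"
    and g: "g integrable_on ball 0 1" "\<And>y. norm y < 1 \<Longrightarrow> \<bar>g y\<bar> \<le> B"
    and int: "\<And>n. (\<lambda>y. (- 1 + (X n /\<^sub>R norm (X n)) \<bullet> y) * g y / denom (norm (X n) + d) (X n) y)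
       absolutely_integrable_on ball 0 1"
  shows "(\<lambda>n. norm (X n) * integral (ball 0 1)
      (\<lambda>y. (- 1 + (X n /\<^sub>R norm (X n)) \<bullet> y) * g y / denom (norm (X n) + d) (X n) y))
    \<longlonglongrightarrow> - integral (ball 0 1) g"
proof -
  define a where "a n y = angular_gap (X n) y" for n y
  define R where "R n y = norm (X n) * a n y / denom (norm (X n) + d) (X n) y" for n y
  define P where "P n = {y. norm (X n) * a n y \<ge> 2 * d}" for n
  define \<tau> where "\<tau> n = sqrt (2 * norm (X n) * d + d\<^sup>2)" for n
  define C where "C = integral (ball 0 2) (\<lambda>z::real^3. 1 / norm z)"
  have rc: "retarded_charge (X n) y d" if "norm y < 1" for n y using X(1) that d by unfold_locales
  have B: "B \<ge> 0" using g(2)[of 0] by simp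
  have F: "(\<lambda>y. g y * R n y) absolutely_integrable_on ball 0 1"
    and Feq: "norm (X n) * integral (ball 0 1)
      (\<lambda>y. (- 1 + (X n /\<^sub>R norm (X n)) \<bullet> y) * g y / denom (norm (X n) + d) (X n) y)
      = - integral (ball 0 1) (\<lambda>y. g y * R n y)" for n
  proof -
    have eq: "g y * R n y = - norm (X n) * ((- 1 + (X n /\<^sub>R norm (X n)) \<bullet> y) * g y / denom (norm (X n) + d) (X n) y)" for y
      unfolding R_def a_def angular_gap_def by (simp add: algebra_simps diff_divide_distrib add_divide_distrib)
    show "(\<lambda>y. g y * R n y) absolutely_integrable_on ball 0 1"
      unfolding eq by (intro set_integrable_mult_right int)
    show "norm (X n) * integral (ball 0 1)
      (\<lambda>y. (- 1 + (X n /\<^sub>R norm (X n)) \<bullet> y) * g y / denom (norm (X n) + d) (X n) y)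
      = - integral (ball 0 1) (\<lambda>y. g y * R n y)"
      unfolding eq integral_mult_right by simp
  qed
  have PB: "P n \<inter> ball 0 1 \<in> sets lebesgue" for n
  proof -
    have "closed (P n)" unfolding P_def a_def angular_gap_def by (intro closed_Collect_le continuous_intros)
    then have "P n \<inter> ball 0 1 \<in> sets borel" by (intro sets.Int) auto
    then show ?thesis by simp
  qed
  have F1: "(\<lambda>y. if y \<in> P n then g y * R n y else 0) integrable_on ball 0 1" for n
    unfolding integrable_restrict_Int
    by (intro set_lebesgue_integral_eq_integral(1) set_integrable_subset[OF F PB]) auto
  have F0: "(\<lambda>y. g y * R n y) integrable_on ball 0 1" for n
    using F set_lebesgue_integral_eq_integral(1) by blast
  \<comment> \<open>The integral of \<open>g y * R n y\<close> is that of \<open>g\<close>, minus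
    that of \<open>h n\<close>, plus that of \<open>k n\<close>. Here \<open>h n\<close> stays
    bounded and tends to zero pointwise, while \<open>k n\<close> lives off \<open>P n\<close> and
    carries the singularity.\<close>
  define h where "h n y = g y - (if y \<in> P n then g y * R n y else 0)" for n y
  define k where "k n y = g y * R n y - (if y \<in> P n then g y * R n y else 0)" for n y
  have "(\<lambda>n. integral (ball 0 1) (h n)) \<longlonglongrightarrow> integral (ball (0::real^3) 1) (\<lambda>y. 0::real)"
  proof (rule dominated_convergence(2))
    show "h n integrable_on ball 0 1" for n unfolding h_def by (intro integrable_diff g F1)
    show "(\<lambda>y. 3 * B) integrable_on ball (0::real^3) 1" by (intro integrable_on_const) simp
    show "norm (h n y) \<le> 3 * B" if "y \<in> ball 0 1" for n y
    proof -
      have y: "norm y < 1" using that by simp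
      have "\<bar>g y * R n y\<bar> \<le> B * 2" if "y \<in> P n"
      proof -
        have "0 \<le> R n y \<and> R n y \<le> 2"
          using retarded_charge.ratio_far[OF rc[OF y], of n] that unfolding R_def P_def a_def by simp
        then show ?thesis unfolding abs_mult using g(2)[OF y] by (intro mult_mono) auto
      qed
      then show ?thesis unfolding h_def using g(2)[OF y] B by auto
    qed
    show "(\<lambda>n. h n y) \<longlonglongrightarrow> 0" if "y \<in> ball 0 1" for y
    proof -
      have y: "norm y < 1" using that by simp
      have lim: "(\<lambda>n. R n y) \<longlonglongrightarrow> 1"
        unfolding R_def a_def by (rule ratio_tendsto[OF X y d])
      \<comment> \<open>For fixed \<open>y\<close> the gap is at least \<open>1 - norm y\<close>, so
        \<open>y\<close> belongs to \<open>P n\<close> for all large \<open>n\<close>.\<close>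
      have "eventually (\<lambda>n. norm (X n) \<ge> 2 * d / (1 - norm y)) sequentially"
        using X(2) unfolding filterlim_at_top by blast
      then have "eventually (\<lambda>n. g y * (1 - R n y) = h n y) sequentially"
      proof eventually_elim
        case (elim n)
        have "2 * d \<le> norm (X n) * (1 - norm y)" using elim y by (simp add: field_simps)
        also have "\<dots> \<le> norm (X n) * a n y"
          using retarded_charge.gap_ge[OF rc[OF y]] unfolding a_def by (intro mult_left_mono) auto
        finally have "y \<in> P n" by (simp add: P_def)
        then show ?case by (simp add: h_def algebra_simps)
      qed
      moreover have "(\<lambda>n. g y * (1 - R n y)) \<longlonglongrightarrow> g y * (1 - 1)"
        by (intro tendsto_intros lim)
      ultimately show ?thesis using Lim_transform_eventually by fastforce
    qed
  qed
  then have h0: "(\<lambda>n. integral (ball 0 1) (h n)) \<longlonglongrightarrow> 0" by simp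
  have kbound: "norm (integral (ball 0 1) (k n)) \<le> B * (2 * d) * C / \<tau> n" for n
  proof -
    let ?w = "X n /\<^sub>R (norm (X n) + d)"
    have pos: "norm (X n) + d > 0" using d by (simp add: add_nonneg_pos)
    then have "norm ?w = norm (X n) / (norm (X n) + d)" by (simp add: divide_inverse)
    then have w: "norm ?w < 1" using pos d by (simp only: divide_less_eq_1_pos)
    have ki: "k n integrable_on ball 0 1" unfolding k_def by (intro integrable_diff F0 F1)
    have hi: "((\<lambda>y. B * (2 * d) / \<tau> n * (if y \<in> ball ?w 2 then 1 / norm (y - ?w) else 0))
        has_integral (B * (2 * d) / \<tau> n * C)) UNIV"
      unfolding C_def by (intro has_integral_mult_right has_integral_inverse_dist)
    have \<tau>: "\<tau> n > 0" using d by (simp add: \<tau>_def add_nonneg_pos)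
    have "norm (if y \<in> ball 0 1 then k n y else 0) \<le> B * (2 * d) / \<tau> n * (if y \<in> ball ?w 2 then 1 / norm (y - ?w) else 0)" for y
    proof (cases "y \<in> ball 0 1 \<and> y \<notin> P n")
      case True
      then have y: "norm y < 1" by simp
      have "norm (y - ?w) < 2" using norm_triangle_ineq4[of y ?w] w y by simp
      then have yw: "y \<in> ball ?w 2" by (simp add: dist_norm norm_minus_commute)
      have "\<bar>R n y\<bar> \<le> 2 * d / \<tau> n * (1 / norm (y - ?w))"
        using retarded_charge.ratio_near[OF rc[OF y], of n] True unfolding R_def P_def a_def \<tau>_def by simp
      then have "\<bar>g y * R n y\<bar> \<le> B * (2 * d / \<tau> n * (1 / norm (y - ?w)))"
        unfolding abs_mult using g(2)[OF y] B by (intro mult_mono) auto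
      then show ?thesis using True yw by (simp add: k_def mult_ac)
    next
      case False
      then show ?thesis using B d \<tau> by (auto simp: k_def)
    qed
    then have "norm (integral UNIV (\<lambda>y. if y \<in> ball 0 1 then k n y else 0))
        \<le> integral UNIV (\<lambda>y. B * (2 * d) / \<tau> n * (if y \<in> ball ?w 2 then 1 / norm (y - ?w) else 0))"
      by (intro integral_norm_bound_integral has_integral_integrable[OF hi])
        (use ki in \<open>simp only: integrable_restrict_UNIV\<close>)
    then have "norm (integral UNIV (\<lambda>y. if y \<in> ball 0 1 then k n y else 0)) \<le> B * (2 * d) / \<tau> n * C"
      by (simp only: integral_unique[OF hi])
    then have "norm (integral (ball 0 1) (k n)) \<le> B * (2 * d) / \<tau> n * C"
      by (simp only: integral_restrict_UNIV)
    then show ?thesis by (simp add: mult_ac)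
  qed
  have "(\<lambda>n. B * (2 * d) * C / \<tau> n) \<longlonglongrightarrow> 0"
  proof (rule tendsto_divide_0[OF tendsto_const])
    have "filterlim (\<lambda>n. (2 * d) * norm (X n)) at_top sequentially"
      using d by (intro filterlim_tendsto_pos_mult_at_top[OF tendsto_const] X(2)) auto
    then have "filterlim (\<lambda>n. d\<^sup>2 + (2 * d) * norm (X n)) at_top sequentially"
      by (intro filterlim_tendsto_add_at_top[OF tendsto_const])
    then have "filterlim (\<lambda>n. sqrt (d\<^sup>2 + (2 * d) * norm (X n))) at_top sequentially"
      by (rule filterlim_compose[OF sqrt_at_top])
    then have "filterlim \<tau> at_top sequentially" unfolding \<tau>_def by (simp add: mult_ac add.commute)
    then show "filterlim \<tau> at_infinity sequentially" by (rule filterlim_at_top_imp_at_infinity)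
  qed
  then have k0: "(\<lambda>n. integral (ball 0 1) (k n)) \<longlonglongrightarrow> 0"
    by (rule Lim_null_comparison[OF always_eventually[OF allI[OF kbound]]])
  have "integral (ball 0 1) (\<lambda>y. g y * R n y)
      = integral (ball 0 1) g - integral (ball 0 1) (h n) + integral (ball 0 1) (k n)" for n
    unfolding h_def k_def using integral_diff[OF g(1) F1] integral_diff[OF F0 F1] by simp
  then have "(\<lambda>n. integral (ball 0 1) (\<lambda>y. g y * R n y)) \<longlonglongrightarrow> integral (ball 0 1) g - 0 + 0"
    by (simp only:) (intro tendsto_intros h0 k0)
  then show ?thesis unfolding Feq by (intro tendsto_minus) simp
qed

section \<open>The asymptotic potential\<close>

lemma dir_deriv_future_eq:
  assumes "(f has_derivative f') (at p within future)" "p \<in> future"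
  shows "dir_deriv future v f p = f' v"
proof -
  have "frechet_derivative f (at p within future) = f'"
  proof (rule frechet_derivative_unique_within)
    show "(f has_derivative frechet_derivative f (at p within future)) (at p within future)"
      using assms(1) frechet_derivative_works differentiable_def by blast
    show "(f has_derivative f') (at p within future)" by fact
    show "\<exists>d. 0 < \<bar>d\<bar> \<and> \<bar>d\<bar> < e \<and> p + d *\<^sub>R i \<in> future" if "i \<in> Basis" "e > 0" for i e
    proof (rule exI[of _ "e / 2"])
      \<comment> \<open>Basis vectors never point into the past, so positive steps stay in the
        half-space even from its boundary; this gives uniqueness of the derivative there.\<close>
      have "0 \<le> fst i" using that(1) by (auto simp: Basis_prod_def)
      then have "0 \<le> e / 2 * fst i" using that(2) by simp
      then show "0 < \<bar>e / 2\<bar> \<and> \<bar>e / 2\<bar> < e \<and> p + (e / 2) *\<^sub>R i \<in> future"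
        using assms(2) that by (auto simp: future_def mem_Times_iff)
    qed
  qed
  then show ?thesis by (simp add: dir_deriv_def)
qed

lemma pderivs_inner:
  assumes A: "C_k_on k future A"
  shows "I \<in> lists Basis \<Longrightarrow> length I \<le> k \<Longrightarrow> p \<in> future \<Longrightarrow>
    pderivs future I (\<lambda>p. A p \<bullet> c) p = pderivs future I A p \<bullet> c"
    and "I \<in> lists Basis \<Longrightarrow> length I < k \<Longrightarrow>
      pderivs future I (\<lambda>p. A p \<bullet> c) differentiable_on future"
proof -
  have step: "(pderivs future I (\<lambda>p. A p \<bullet> c) has_derivative
      (\<lambda>h. frechet_derivative (pderivs future I A) (at p within future) h \<bullet> c)) (at p within future)"
    if eq: "\<And>p. p \<in> future \<Longrightarrow> pderivs future I (\<lambda>p. A p \<bullet> c) p = pderivs future I A p \<bullet> c"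
      and I: "I \<in> lists Basis" "length I < k" and p: "p \<in> future" for I p
  proof -
    have "pderivs future I A differentiable (at p within future)"
      using A I p by (auto simp: C_k_on_def differentiable_on_def)
    then have "(pderivs future I A has_derivative frechet_derivative (pderivs future I A) (at p within future)) (at p within future)"
      by (simp add: frechet_derivative_works)
    then have "((\<lambda>p. pderivs future I A p \<bullet> c) has_derivative
      (\<lambda>h. frechet_derivative (pderivs future I A) (at p within future) h \<bullet> c)) (at p within future)"
      by (rule has_derivative_inner_left)
    then show ?thesis
      by (rule has_derivative_transform[OF p, rotated]) (simp add: eq)
  qed
  show eq: "pderivs future I (\<lambda>p. A p \<bullet> c) p = pderivs future I A p \<bullet> c"
    if "I \<in> lists Basis" "length I \<le> k" "p \<in> future" for I p
    using that
  proof (induction I arbitrary: p)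
    case (Cons v I)
    have IH: "pderivs future I (\<lambda>p. A p \<bullet> c) p = pderivs future I A p \<bullet> c" if "p \<in> future" for p
      using Cons that by auto
    have "dir_deriv future v (pderivs future I (\<lambda>p. A p \<bullet> c)) p
        = frechet_derivative (pderivs future I A) (at p within future) v \<bullet> c"
      by (rule dir_deriv_future_eq[OF step[OF IH]]) (use Cons in auto)
    then show ?case by (simp add: dir_deriv_def)
  qed simp
  show "pderivs future I (\<lambda>p. A p \<bullet> c) differentiable_on future"
    if "I \<in> lists Basis" "length I < k" for I
    unfolding differentiable_on_def differentiable_def
    using step[of I] eq[of I] that by (metis less_imp_le)
qed

lemma C_k_on_inner:
  assumes "C_k_on k future A"
  shows "C_k_on k future (\<lambda>p. A p \<bullet> c)"
proof -
  have "continuous_on future (pderivs future I (\<lambda>p. A p \<bullet> c))" if "I \<in> lists Basis" "length I \<le> k" for I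
  proof (rule continuous_on_eq)
    show "continuous_on future (\<lambda>p. pderivs future I A p \<bullet> c)"
      by (intro continuous_intros pderivs_continuous[OF assms that])
  qed (simp add: pderivs_inner(1)[OF assms that])
  then show ?thesis
    unfolding C_k_on_def using pderivs_inner(2)[OF assms] by blast
qed

text \<open>Contracting with a constant covector commutes with all derivatives. For the component
  along L at a point, \<omega> is frozen at its value there, so it is never differentiated.\<close>

lemma potential_component:
  assumes "is_potential a\<^sub>p a\<^sub>m A" "t0 > 2"
  shows "cauchy_problem (\<lambda>p. A p \<bullet> c) (\<lambda>p. source a\<^sub>p a\<^sub>m p \<bullet> c) t0"
proof
  have A: "C_k_on 2 future A"
    and box: "\<And>p. p \<in> future \<Longrightarrow> - box future A p = source a\<^sub>p a\<^sub>m p"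
    and init: "\<And>x. A (2, x) = 0" "\<And>x. dir_deriv future e_t A (2, x) = 0"
    using assms(1) by (auto simp: is_potential_def)
  note inner = pderivs_inner(1)[OF A, where c = c]
  show "C_k_on 2 future (\<lambda>p. A p \<bullet> c)" by (rule C_k_on_inner[OF A])
  show "- box future (\<lambda>p. A p \<bullet> c) p = source a\<^sub>p a\<^sub>m p \<bullet> c" if p: "p \<in> future" for p
  proof -
    have "pderivs future [e_t, e_t] (\<lambda>p. A p \<bullet> c) p = pderivs future [e_t, e_t] A p \<bullet> c"
      and "pderivs future [e_x i, e_x i] (\<lambda>p. A p \<bullet> c) p = pderivs future [e_x i, e_x i] A p \<bullet> c" for i
      by (rule inner; simp add: p e_t_in_Basis e_x_in_Basis)+
    then have "box future (\<lambda>p. A p \<bullet> c) p = box future A p \<bullet> c"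
      unfolding box_def by (simp add: inner_add_left inner_diff_left inner_sum_left del: pderivs.simps)
    then show ?thesis using box[OF p] by (metis inner_minus_left)
  qed
  show "A (2, x) \<bullet> c = 0" for x using init by simp
  show "dir_deriv future e_t (\<lambda>p. A p \<bullet> c) (2, x) = 0" for x
    using inner[of "[e_t]" "(2, x)"] init by (simp add: e_t_in_Basis future_def)
  show "t0 > 2" by fact
qed

section \<open>Charge density in velocity space\<close>

definition charge :: "(real^3 \<Rightarrow> complex) \<Rightarrow> (real^3 \<Rightarrow> complex) \<Rightarrow> real^3 \<Rightarrow> real" where
  "charge a\<^sub>p a\<^sub>m y = ((cmod (a\<^sub>p y))\<^sup>2 - (cmod (a\<^sub>m y))\<^sup>2) / (1 - (norm y)\<^sup>2)\<^sup>2"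

text \<open>This is the homogeneous shape that \<open>lienard_wiechert\<close> expects. The fourth
  power of \<open>tau p\<close> is \<open>fst p ^ 4\<close> times the square of
  \<open>1 - (norm (vel p))\<^sup>2\<close>, which supplies the weight of \<open>dH1\<close> inside
  \<open>charge\<close>.\<close>

lemma source_component:
  "source a\<^sub>p a\<^sub>m p \<bullet> (1, \<omega>) =
    (if norm (snd p) < fst p then (- 1 + \<omega> \<bullet> vel p) * charge a\<^sub>p a\<^sub>m (vel p) / fst p ^ 3 else 0)"
proof (cases "norm (snd p) < fst p")
  case True
  define t x y where "t = fst p" and "x = snd p" and "y = vel p"
  have t: "t > 0" using True norm_ge_zero[of "snd p"] unfolding t_def by linarith
  have x: "x = t *\<^sub>R y" using t by (simp add: x_def y_def vel_def t_def)
  have nt: "norm x < t" using True by (simp add: x_def t_def)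
  have y: "norm y < 1" using nt t x by simp
  have b: "1 - (norm y)\<^sup>2 > 0" using y by (simp add: power_less_one_iff)
  have \<tau>2: "(tau p)\<^sup>2 = t\<^sup>2 * (1 - (norm y)\<^sup>2)"
  proof -
    have "(norm x)\<^sup>2 = t\<^sup>2 * (norm y)\<^sup>2" using t x by (simp add: power_mult_distrib)
    then have "t\<^sup>2 - (norm x)\<^sup>2 = t\<^sup>2 * (1 - (norm y)\<^sup>2)" by (simp add: algebra_simps)
    then show ?thesis using b t by (simp add: tau_def t_def[symmetric] x_def[symmetric])
  qed
  have "tau p ^ 4 = ((tau p)\<^sup>2)\<^sup>2" by simp
  also have "\<dots> = t ^ 4 * (1 - (norm y)\<^sup>2)\<^sup>2" unfolding \<tau>2 by (simp add: power_mult_distrib)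
  finally have \<tau>4: "tau p ^ 4 = t ^ 4 * (1 - (norm y)\<^sup>2)\<^sup>2" .
  have "lower p \<bullet> (1, \<omega>) = t * (- 1 + \<omega> \<bullet> y)"
    unfolding lower_def x_def[symmetric] t_def[symmetric] by (simp add: x inner_commute algebra_simps)
  then have "source a\<^sub>p a\<^sub>m p \<bullet> (1, \<omega>)
      = ((cmod (a\<^sub>p y))\<^sup>2 - (cmod (a\<^sub>m y))\<^sup>2) * (t * (- 1 + \<omega> \<bullet> y)) / tau p ^ 4"
    using True by (simp add: source_def y_def[symmetric] divide_inverse power_Suc eval_nat_numeral mult_ac)
  also have "\<dots> = (- 1 + \<omega> \<bullet> y) * charge a\<^sub>p a\<^sub>m y / t ^ 3"
  proof -
    have "f * (t * w) / (t ^ 4 * B) = w * (f / B) / t ^ 3" if "B > 0" for f w B :: real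
      using t that by (simp add: field_simps eval_nat_numeral)
    then show ?thesis unfolding \<tau>4 charge_def using b by simp
  qed
  finally show ?thesis using True by (simp add: y_def t_def)
qed (simp add: source_def)

text \<open>The estimate for the empty multi-index bounds the squared modulus by a multiple of the
  power 2\<alpha> of 1 - |y|^2, and \<alpha> \<ge> 1 absorbs the weight of
  \<open>dH1\<close>.\<close>

lemma decaying_profile_bound:
  assumes "decaying_profile N \<alpha> \<epsilon> a" "\<alpha> \<ge> 1"
  shows "continuous_on (ball 0 1) a"
    and "\<exists>K. \<forall>y. norm y < 1 \<longrightarrow> (cmod (a y))\<^sup>2 / (1 - (norm y)\<^sup>2)\<^sup>2 \<le> K"
proof -
  show "continuous_on (ball 0 1) a"
    using assms(1) unfolding decaying_profile_def C_k_on_def by (metis le0 list.size(3) lists.Nil pderivs.simps(1))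
  obtain C where "\<And>I y. I \<in> lists Basis \<Longrightarrow> length I \<le> N \<Longrightarrow> y \<in> ball 0 1 \<Longrightarrow>
      norm ((1 - (norm y)\<^sup>2) ^ length I *\<^sub>R pderivs (ball 0 1) I a y) \<le> C * (\<epsilon> * (1 - (norm y)\<^sup>2) powr \<alpha>)"
    using assms(1) unfolding decaying_profile_def by blast
  from this[of "[]"] have C: "cmod (a y) \<le> C * \<epsilon> * (1 - (norm y)\<^sup>2) powr \<alpha>" if "norm y < 1" for y
    using that by (simp add: mult.assoc)
  have "(cmod (a y))\<^sup>2 / (1 - (norm y)\<^sup>2)\<^sup>2 \<le> (C * \<epsilon>)\<^sup>2" if y: "norm y < 1" for y
  proof -
    have b: "1 - (norm y)\<^sup>2 > 0" "1 - (norm y)\<^sup>2 \<le> 1" using y by (auto simp: power_less_one_iff)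
    have "(1 - (norm y)\<^sup>2) powr \<alpha> \<le> (1 - (norm y)\<^sup>2) powr 1"
      using b assms(2) by (intro powr_mono') auto
    then have le: "(1 - (norm y)\<^sup>2) powr \<alpha> \<le> 1 - (norm y)\<^sup>2" using b by simp
    have "cmod (a y) \<le> \<bar>C * \<epsilon>\<bar> * (1 - (norm y)\<^sup>2) powr \<alpha>"
      by (rule order_trans[OF C[OF y]]) (intro mult_right_mono; simp)
    also have "\<dots> \<le> \<bar>C * \<epsilon>\<bar> * (1 - (norm y)\<^sup>2)" using le by (intro mult_left_mono) auto
    finally have "(cmod (a y))\<^sup>2 \<le> (\<bar>C * \<epsilon>\<bar> * (1 - (norm y)\<^sup>2))\<^sup>2" by (intro power_mono) auto
    then show ?thesis using b by (simp add: power_mult_distrib divide_le_eq)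
  qed
  then show "\<exists>K. \<forall>y. norm y < 1 \<longrightarrow> (cmod (a y))\<^sup>2 / (1 - (norm y)\<^sup>2)\<^sup>2 \<le> K" by blast
qed

lemma charge_bounded:
  assumes "decaying_profile N \<alpha> \<epsilon> a\<^sub>p" "decaying_profile N \<alpha> \<epsilon> a\<^sub>m" "\<alpha> \<ge> 1"
  shows "continuous_on (ball 0 1) (charge a\<^sub>p a\<^sub>m)"
    and "\<exists>B. \<forall>y. norm y < 1 \<longrightarrow> \<bar>charge a\<^sub>p a\<^sub>m y\<bar> \<le> B"
proof -
  have "(1 - (norm y)\<^sup>2)\<^sup>2 \<noteq> 0" if "norm y < 1" for y :: "real^3"
    using that power_less_one_iff[of "norm y" 2] by simp
  then show "continuous_on (ball 0 1) (charge a\<^sub>p a\<^sub>m)"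
    unfolding charge_def
    by (intro continuous_intros decaying_profile_bound(1)[OF assms(1,3)] decaying_profile_bound(1)[OF assms(2,3)]) auto
  obtain K L where K: "\<And>y. norm y < 1 \<Longrightarrow> (cmod (a\<^sub>p y))\<^sup>2 / (1 - (norm y)\<^sup>2)\<^sup>2 \<le> K"
    and L: "\<And>y. norm y < 1 \<Longrightarrow> (cmod (a\<^sub>m y))\<^sup>2 / (1 - (norm y)\<^sup>2)\<^sup>2 \<le> L"
    using decaying_profile_bound(2)[OF assms(1,3)] decaying_profile_bound(2)[OF assms(2,3)] by blast
  have "\<bar>charge a\<^sub>p a\<^sub>m y\<bar> \<le> K + L" if y: "norm y < 1" for y
  proof -
    have "0 \<le> (cmod (a\<^sub>p y))\<^sup>2 / (1 - (norm y)\<^sup>2)\<^sup>2" "0 \<le> (cmod (a\<^sub>m y))\<^sup>2 / (1 - (norm y)\<^sup>2)\<^sup>2" by simp_all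
    then show ?thesis
      using K[OF y] L[OF y] unfolding charge_def diff_divide_distrib by linarith
  qed
  then show "\<exists>B. \<forall>y. norm y < 1 \<longrightarrow> \<bar>charge a\<^sub>p a\<^sub>m y\<bar> \<le> B" by blast
qed

lemma q_infinity_eq:
  assumes "continuous_on (ball 0 1) (charge a\<^sub>p a\<^sub>m)" "\<And>y. norm y < 1 \<Longrightarrow> \<bar>charge a\<^sub>p a\<^sub>m y\<bar> \<le> B"
    and "continuous_on (ball 0 1) a\<^sub>p" "continuous_on (ball 0 1) a\<^sub>m"
  shows "charge a\<^sub>p a\<^sub>m integrable_on ball 0 1"
    and "q_infinity a\<^sub>p a\<^sub>m = - integral (ball 0 1) (charge a\<^sub>p a\<^sub>m) / (4 * pi)"
proof -
  let ?g = "charge a\<^sub>p a\<^sub>m" and ?B = "ball (0::real^3) 1"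
  have si: "set_integrable lborel ?B ?g"
    unfolding set_integrable_def
  proof (rule integrableI_bounded_set[where A = ?B and B = B])
    show "emeasure lborel ?B < \<infinity>" by (rule emeasure_bounded_finite) simp
    show "AE x in lborel. x \<in> ?B \<longrightarrow> norm (indicator ?B x *\<^sub>R ?g x) \<le> B" using assms(2) by simp
    show "AE x in lborel. x \<notin> ?B \<longrightarrow> indicator ?B x *\<^sub>R ?g x = 0" by simp
    show "?B \<in> sets lborel" by simp
    show "(\<lambda>x. indicator ?B x *\<^sub>R ?g x) \<in> borel_measurable lborel"
      using borel_measurable_continuous_on_indicator[OF _ assms(1)] by simp
  qed
  then show "?g integrable_on ?B" by (rule set_borel_integral_eq_integral(1))
  let ?f = "\<lambda>y. (cmod (a\<^sub>m y))\<^sup>2 - (cmod (a\<^sub>p y))\<^sup>2"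
  have "continuous_on ?B ?f" by (intro continuous_intros assms)
  then have mf: "?f \<in> borel_measurable (restrict_space lborel ?B)"
    using borel_measurable_continuous_on_restrict[of ?B ?f] by (simp add: measurable_cong_sets[OF sets_restrict_space_cong[OF sets_lborel]])
  have "(LINT y|dH1. ?f y) = (LINT y|restrict_space lborel ?B. (1 / (1 - (norm y)\<^sup>2)\<^sup>2) *\<^sub>R ?f y)"
    unfolding dH1_def
    by (rule integral_density[OF mf]) (auto intro!: measurable_restrict_space1)
  also have "\<dots> = (LINT y:?B|lborel. (1 / (1 - (norm y)\<^sup>2)\<^sup>2) *\<^sub>R ?f y)"
    by (subst integral_restrict_space) (auto simp: set_lebesgue_integral_def)
  also have "\<dots> = (LINT y:?B|lborel. - ?g y)"
    by (intro set_lebesgue_integral_cong) (auto simp: charge_def diff_divide_distrib)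
  also have "\<dots> = - (LINT y:?B|lborel. ?g y)" by (simp add: set_lebesgue_integral_def)
  also have "(LINT y:?B|lborel. ?g y) = integral ?B ?g" by (rule set_borel_integral_eq_integral(2)[OF si])
  finally show "q_infinity a\<^sub>p a\<^sub>m = - integral ?B ?g / (4 * pi)"
    by (simp add: q_infinity_def)
qed

lemma L_comp_eq_inner: "L_comp \<omega> V = V \<bullet> (1, \<omega>)"
  by (cases V) (simp add: L_comp_def inner_commute)

text \<open>The limit over all directions is reduced to sequences by contradiction, because
  dominated convergence acts along sequences.\<close>

lemma potential_limit:
  fixes d :: real
  assumes prof: "decaying_profile N \<alpha> \<epsilon> a\<^sub>p" "decaying_profile N \<alpha> \<epsilon> a\<^sub>m" "\<alpha> \<ge> 1"
    and pot: "is_potential a\<^sub>p a\<^sub>m A" and d: "d \<ge> 4"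
  shows "((\<lambda>x. norm x * L_comp (x /\<^sub>R norm x) (A (norm x + d, x))) \<longlongrightarrow> q_infinity a\<^sub>p a\<^sub>m) at_infinity"
proof (rule ccontr)
  let ?H = "\<lambda>x. norm x * L_comp (x /\<^sub>R norm x) (A (norm x + d, x))"
  let ?g = "charge a\<^sub>p a\<^sub>m"
  obtain B where B: "\<And>y. norm y < 1 \<Longrightarrow> \<bar>?g y\<bar> \<le> B" using charge_bounded(2)[OF prof] by blast
  note q = q_infinity_eq[OF charge_bounded(1)[OF prof] B
      decaying_profile_bound(1)[OF prof(1,3)] decaying_profile_bound(1)[OF prof(2,3)]]
  assume "\<not> (?H \<longlongrightarrow> q_infinity a\<^sub>p a\<^sub>m) at_infinity"
  then obtain e where e: "e > 0" "\<not> eventually (\<lambda>x. dist (?H x) (q_infinity a\<^sub>p a\<^sub>m) < e) at_infinity"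
    unfolding tendsto_iff by blast
  \<comment> \<open>\<open>Suc n\<close> rather than \<open>n\<close> keeps every \<open>X n\<close>
    away from the origin, where the direction is undefined.\<close>
  then have "\<forall>n::nat. \<exists>x. norm x \<ge> real (Suc n) \<and> \<not> dist (?H x) (q_infinity a\<^sub>p a\<^sub>m) < e"
    unfolding eventually_at_infinity by blast
  then obtain X where X: "\<And>n. norm (X n) \<ge> real (Suc n)" "\<And>n. \<not> dist (?H (X n)) (q_infinity a\<^sub>p a\<^sub>m) < e"
    by metis
  have X0: "X n \<noteq> 0" for n using X(1)[of n] by auto
  have Xlim: "filterlim (\<lambda>n. norm (X n)) at_top sequentially"
  proof (rule filterlim_at_top_mono)
    show "filterlim (\<lambda>n. real (Suc n)) at_top sequentially"
      by (rule filterlim_compose[OF filterlim_real_sequentially filterlim_Suc])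
  qed (use X in auto)
  let ?k = "\<lambda>n y. (- 1 + (X n /\<^sub>R norm (X n)) \<bullet> y) * ?g y"
  have LW: "(\<lambda>y. ?k n y / denom (norm (X n) + d) (X n) y) absolutely_integrable_on ball 0 1"
    "integral (ball 0 1) (\<lambda>y. ?k n y / denom (norm (X n) + d) (X n) y)
      = 4 * pi * (A (norm (X n) + d, X n) \<bullet> (1, X n /\<^sub>R norm (X n)))" for n
  proof -
    have "norm (X n) + d > 2" using d norm_ge_zero[of "X n"] by linarith
    then interpret cauchy_problem "\<lambda>p. A p \<bullet> (1, X n /\<^sub>R norm (X n))" "\<lambda>p. source a\<^sub>p a\<^sub>m p \<bullet> (1, X n /\<^sub>R norm (X n))"
      "norm (X n) + d" "X n"
      by (rule potential_component[OF pot])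
    show "(\<lambda>y. ?k n y / denom (norm (X n) + d) (X n) y) absolutely_integrable_on ball 0 1"
      "integral (ball 0 1) (\<lambda>y. ?k n y / denom (norm (X n) + d) (X n) y)
      = 4 * pi * (A (norm (X n) + d, X n) \<bullet> (1, X n /\<^sub>R norm (X n)))"
      by (rule lienard_wiechert[OF source_component]; use d in simp)+
  qed
  have "d > 0" using d by simp
  from charge_limit[OF X0 Xlim this q(1) B LW(1)]
  have "(\<lambda>n. norm (X n) * (4 * pi * (A (norm (X n) + d, X n) \<bullet> (1, X n /\<^sub>R norm (X n)))))
      \<longlonglongrightarrow> - integral (ball 0 1) ?g"
    unfolding LW(2) .
  then have "(\<lambda>n. norm (X n) * (4 * pi * (A (norm (X n) + d, X n) \<bullet> (1, X n /\<^sub>R norm (X n)))) / (4 * pi))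
      \<longlonglongrightarrow> - integral (ball 0 1) ?g / (4 * pi)"
    by (intro tendsto_divide tendsto_const) auto
  then have "(\<lambda>n. ?H (X n)) \<longlonglongrightarrow> q_infinity a\<^sub>p a\<^sub>m"
    using q(2) by (simp add: L_comp_eq_inner)
  from tendstoD[OF this e(1)] show False using X(2) by (simp add: eventually_sequentially) 
qed

theorem proposition1:
  fixes a\<^sub>p a\<^sub>m :: "real ^ 3 \<Rightarrow> complex"
    and N :: nat and \<alpha> \<epsilon> q :: real
    and A :: "spacetime \<Rightarrow> covector"
    and U :: "real ^ 3 \<Rightarrow> covector"
  assumes "N \<ge> 5" and "\<alpha> \<ge> 7 / 4" and "\<epsilon> > 0"
    and "decaying_profile N \<alpha> \<epsilon> a\<^sub>p" and "decaying_profile N \<alpha> \<epsilon> a\<^sub>m"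
    and "is_potential a\<^sub>p a\<^sub>m A"
    and "is_profile_of U A"
    and "q < 0"
  shows "((\<lambda>x. let p = (norm x - q, x)
               in norm x * (L_comp (x /\<^sub>R norm x) (U (vel p)) / tau p))
           \<longlongrightarrow> q_infinity a\<^sub>p a\<^sub>m) at_infinity"
proof -
  \<comment> \<open>scaling by \<open>c\<close> moves \<open>t - |x| = -q\<close> to \<open>t - |x| = 4\<close>\<close>
  define c where "c = 4 / (- q)"
  have c: "c > 0" "c * (- q) = 4" using \<open>q < 0\<close> by (auto simp: c_def field_simps)
  have eq: "(let p = (norm x - q, x) in norm x * (L_comp (x /\<^sub>R norm x) (U (vel p)) / tau p))
      = norm (c *\<^sub>R x) * L_comp ((c *\<^sub>R x) /\<^sub>R norm (c *\<^sub>R x)) (A (norm (c *\<^sub>R x) + 4, c *\<^sub>R x))" for x :: "real^3"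
  proof -
    let ?p = "(norm x - q, x)"
    \<comment> \<open>The scaled point lies where potential and profile agree. Its velocity is
      unchanged, and the factor \<open>c\<close> in \<open>tau\<close> cancels against that in
      \<open>norm (c *\<^sub>R x)\<close>.\<close>
    have cp: "(norm (c *\<^sub>R x) + 4, c *\<^sub>R x) = c *\<^sub>R ?p"
      using c by (simp add: algebra_simps)
    have vel: "vel (c *\<^sub>R ?p) = vel ?p" using c by (simp add: vel_def)
    have "(fst (c *\<^sub>R ?p))\<^sup>2 - (norm (snd (c *\<^sub>R ?p)))\<^sup>2 = c\<^sup>2 * ((fst ?p)\<^sup>2 - (norm (snd ?p))\<^sup>2)"
      by (simp only: fst_scaleR snd_scaleR norm_scaleR real_scaleR_def power_mult_distrib power2_abs right_diff_distrib)
    then have tau: "tau (c *\<^sub>R ?p) = c * tau ?p"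
      using c by (simp add: tau_def real_sqrt_mult)
    have "A (c *\<^sub>R ?p) = U (vel ?p) /\<^sub>R (c * tau ?p)"
      using \<open>is_profile_of U A\<close> unfolding is_profile_of_def vel[symmetric] tau[symmetric] cp[symmetric] by simp
    then have L: "L_comp (x /\<^sub>R norm x) (A (c *\<^sub>R ?p)) = L_comp (x /\<^sub>R norm x) (U (vel ?p)) / (c * tau ?p)"
      by (simp add: L_comp_eq_inner divide_inverse)
    have dir: "(c *\<^sub>R x) /\<^sub>R norm (c *\<^sub>R x) = x /\<^sub>R norm x" using c by simp
    have "norm (c *\<^sub>R x) * L_comp ((c *\<^sub>R x) /\<^sub>R norm (c *\<^sub>R x)) (A (c *\<^sub>R ?p))
        = norm x * (L_comp (x /\<^sub>R norm x) (U (vel ?p)) / tau ?p)"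
      unfolding dir L using c by simp
    then show ?thesis unfolding cp Let_def by (rule sym)
  qed
  have "filterlim (\<lambda>x::real^3. c *\<^sub>R x) at_infinity at_infinity"
  proof (rule filterlim_norm_at_top_imp_at_infinity)
    have "filterlim (\<lambda>x::real^3. c * norm x) at_top at_infinity"
      by (intro filterlim_tendsto_pos_mult_at_top[OF tendsto_const c(1)] filterlim_norm_at_top)
    then show "filterlim (\<lambda>x::real^3. norm (c *\<^sub>R x)) at_top at_infinity" using c by simp
  qed
  from filterlim_compose[OF potential_limit[OF assms(4,5) _ assms(6)] this, of 4]
  show ?thesis unfolding eq using assms(2) by simp
qed

end
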